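(* Let $\mathbf{k}$ be a commutative ring and $q\in\mathbf{k}$. Let $Y$ be a subset of $\{1,2,3,\ldots\}$ that is closed under addition (i.e., satisfies $y+z\in Y$ for every $y,z\in Y$). Let $T:=Y^*$ be the set of all compositions whose entries all belong to $Y$. Let $\mathrm{QSym}_T^{(q)}$ be the $\mathbf{k}$-submodule of $\mathrm{QSym}$ spanned by the family $\left(\eta_\alpha^{(q)}\right)_{\alpha\in T}$. Then $\mathrm{QSym}_T^{(q)}$ is a Hopf subalgebra of $\mathrm{QSym}$.
   Context: For an integer $m$, $[m]=\{1,2,\ldots,m\}$ (empty if $m\le 0$). A composition is a finite tuple $\alpha=(\alpha_1,\ldots,\alpha_k)$ of positive integers; its length is $\ell(\alpha)=k$, its size is $|\alpha|=\alpha_1+\cdots+\alpha_k$. $\mathrm{Comp}$ is the set of all compositions (including the empty one), and $\mathrm{Comp}_n$ the set of compositions of size $n$. For $\alpha=(\alpha_1,\ldots,\alpha_k)\in\mathrm{Comp}_n$ set $D(\alpha)=\{\alpha_1+\cdots+\alpha_i \mid i\in[k-1]\}\subseteq[n-1]$, and $\mathrm{rev}\,\alpha=(\alpha_k,\ldots,\alpha_1)$. $\beta\gamma$ denotes concatenation of compositions. $\mathrm{QSym}$ is the Hopf algebra of quasisymmetric functions over $\mathbf{k}$ (a $\mathbf{k}$-subalgebra of $\mathbf{k}[[x_1,x_2,\ldots]]$). It has the $\mathbf{k}$-basis $(M_\alpha)_{\alpha\in\mathrm{Comp}}$ with $M_\alpha=\sum_{i_1<i_2<\cdots<i_\ell}x_{i_1}^{\alpha_1}\cdots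 x_{i_\ell}^{\alpha_\ell}$ for $\alpha=(\alpha_1,\ldots,\alpha_\ell)$. Its coproduct is the $\mathbf{k}$-linear map with $\Delta(M_\alpha)=\sum_{\beta\gamma=\alpha}M_\beta\otimes M_\gamma$; its antipode is the $\mathbf{k}$-linear map with $S(M_\alpha)=(-1)^{\ell(\alpha)}\sum_{\gamma\in\mathrm{Comp}_n;\ D(\gamma)\subseteq D(\mathrm{rev}\,\alpha)}M_\gamma$ for $\alpha\in\mathrm{Comp}_n$. Set $r:=q+1$. For $\alpha\in\mathrm{Comp}_n$, $\eta_\alpha^{(q)}=\sum_{\beta\in\mathrm{Comp}_n;\ D(\beta)\subseteq D(\alpha)}r^{\ell(\beta)}M_\beta\in\mathrm{QSym}$. Convention: a "subcoalgebra" of a $\mathbf{k}$-coalgebra $C$ means a $\mathbf{k}$-submodule $D$ of $C$ such that $\Delta(D)$ is contained in the image of the canonical map $D\otimes D\to C\otimes C$. A Hopf subalgebra is a $\mathbf{k}$-subalgebra (containing $1$) that is a subcoalgebra in this sense and is mapped into itself by the antipode. *)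

theory Defs
  imports Complex_Main "HOL-Library.Multiset" "HOL-Library.Poly_Mapping"
begin

section \<open>Formal power series in countably many variables\<close>

text \<open>
  A monomial in the commuting variables \<open>x\<^sub>1, x\<^sub>2, \<dots>\<close> is a finite multiset of variable indices,
  so multiplication of monomials is multiset union and the degree is the size.  The variables
  are indexed by \<^typ>\<open>nat\<close> starting from 0, i.e. index \<open>i\<close> stands for the variable \<open>x\<^sub>i\<^sub>+\<^sub>1\<close>.
\<close>

typedef 'k mps = "UNIV :: (nat multiset \<Rightarrow> 'k) set"
  morphisms coeff Abs_mps ..

setup_lifting type_definition_mps

lemma mps_eqI: "(\<And>m. coeff f m = coeff g m) \<Longrightarrow> f = g"
  by (simp add: coeff_inject [symmetric] fun_eq_iff)

lemma finite_submsets: "finite {a. a \<subseteq># (m :: 'a multiset)}"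
proof (induction m)
  case empty
  then show ?case by simp
next
  case (add x m)
  have "{a. a \<subseteq># add_mset x m} \<subseteq> {a. a \<subseteq># m} \<union> add_mset x ` {a. a \<subseteq># m}"
  proof
    fix a assume "a \<in> {a. a \<subseteq># add_mset x m}"
    then have a: "a \<subseteq># add_mset x m" by simp
    show "a \<in> {a. a \<subseteq># m} \<union> add_mset x ` {a. a \<subseteq># m}"
    proof (cases "x \<in># a")
      case True
      then obtain b where b: "a = add_mset x b" by (metis insert_DiffM)
      with a have "b \<subseteq># m" by simp
      with b show ?thesis by blast
    next
      case False
      with a have "a \<subseteq># m"
        by (metis diff_single_trivial subset_eq_diff_conv add_mset_add_single)
      then show ?thesis by blast
    qed
  qed
  then show ?case using add finite_subset by blast
qed

lemma finite_mset_splits [simp]: "finite {(a, b). a + b = (m :: 'a multiset)}"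
proof (rule finite_subset)
  show "{(a, b). a + b = m} \<subseteq> {a. a \<subseteq># m} \<times> {a. a \<subseteq># m}" by auto
  show "finite ({a. a \<subseteq># m} \<times> {a. a \<subseteq># m})" by (simp add: finite_submsets)
qed

lemma finite_mset_splits' [simp]: "finite {p. fst p + snd p = (m :: 'a multiset)}"
  using finite_mset_splits [of m] by (simp add: case_prod_unfold)

instantiation mps :: (comm_ring_1) comm_ring_1
begin

lift_definition zero_mps :: "'a mps" is "\<lambda>_. 0" .
lift_definition one_mps :: "'a mps" is "\<lambda>m. of_bool (m = {#})" .
lift_definition plus_mps :: "'a mps \<Rightarrow> 'a mps \<Rightarrow> 'a mps" is "\<lambda>f g m. f m + g m" .
lift_definition uminus_mps :: "'a mps \<Rightarrow> 'a mps" is "\<lambda>f m. - f m" .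
lift_definition minus_mps :: "'a mps \<Rightarrow> 'a mps \<Rightarrow> 'a mps" is "\<lambda>f g m. f m - g m" .
lift_definition times_mps :: "'a mps \<Rightarrow> 'a mps \<Rightarrow> 'a mps"
  is "\<lambda>f g m. \<Sum>(a, b) \<in> {(a, b). a + b = m}. f a * g b" .

instance
proof
  fix f g h :: "'a mps"
  show "f * g * h = f * (g * h)"
  proof (rule mps_eqI)
    fix m
    have "coeff (f * g * h) m
        = (\<Sum>(u, c) \<in> {(u, c). u + c = m}. \<Sum>(a, b) \<in> {(a, b). a + b = u}. coeff f a * coeff g b * coeff h c)"
      by (simp add: times_mps.rep_eq sum_distrib_right case_prod_unfold)
    also have "\<dots> = (\<Sum>(p, q) \<in> (SIGMA p:{(u, c). u + c = m}. {(a, b). a + b = fst p}).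
        coeff f (fst q) * coeff g (snd q) * coeff h (snd p))"
      by (subst sum.Sigma [symmetric]) (auto simp: case_prod_unfold)
    also have "\<dots> = (\<Sum>(p, q) \<in> (SIGMA p:{(a, v). a + v = m}. {(b, c). b + c = snd p}).
        coeff f (fst p) * (coeff g (fst q) * coeff h (snd q)))"
      by (rule sum.reindex_bij_witness
            [where i = "\<lambda>(p, q). ((fst p + fst q, snd q), (fst p, fst q))"
               and j = "\<lambda>(p, q). ((fst q, snd q + snd p), (snd q, snd p))"])
         (auto simp: algebra_simps)
    also have "\<dots> = (\<Sum>(a, v) \<in> {(a, v). a + v = m}. \<Sum>(b, c) \<in> {(b, c). b + c = v}. coeff f a * (coeff g b * coeff h c))"
      by (subst sum.Sigma [symmetric]) (auto simp: case_prod_unfold)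
    also have "\<dots> = coeff (f * (g * h)) m"
      by (simp add: times_mps.rep_eq sum_distrib_left case_prod_unfold)
    finally show "coeff (f * g * h) m = coeff (f * (g * h)) m" .
  qed
  show "f * g = g * f"
  proof (rule mps_eqI)
    fix m
    show "coeff (f * g) m = coeff (g * f) m"
      unfolding times_mps.rep_eq
      by (rule sum.reindex_bij_witness [where i = prod.swap and j = prod.swap])
         (auto simp: algebra_simps)
  qed
  show "1 * f = f"
  proof (rule mps_eqI)
    fix m
    have "coeff (1 * f) m = (\<Sum>(a, b) \<in> {(a, b). a + b = m}. of_bool (a = {#}) * coeff f b)"
      by (simp add: times_mps.rep_eq one_mps.rep_eq)
    also have "\<dots> = (\<Sum>(a, b) \<in> {({#} :: nat multiset, m)}. of_bool (a = {#}) * coeff f b)"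
      by (rule sum.mono_neutral_right) (auto split: if_splits simp: of_bool_def)
    finally show "coeff (1 * f) m = coeff f m" by simp
  qed
  show "(f + g) * h = f * h + g * h"
    by (rule mps_eqI)
       (simp add: times_mps.rep_eq plus_mps.rep_eq sum.distrib algebra_simps case_prod_unfold)
  show "(0 :: 'a mps) \<noteq> 1"
  proof
    assume "(0 :: 'a mps) = 1"
    then have "coeff (0 :: 'a mps) {#} = coeff 1 {#}" by simp
    then show False by (simp add: zero_mps.rep_eq one_mps.rep_eq)
  qed
qed (rule mps_eqI,
     simp add: plus_mps.rep_eq zero_mps.rep_eq minus_mps.rep_eq uminus_mps.rep_eq algebra_simps)+

end

lift_definition mps_scale :: "'k::comm_ring_1 \<Rightarrow> 'k mps \<Rightarrow> 'k mps" is "\<lambda>c f m. c * f m" .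


section \<open>Compositions\<close>

definition Comp :: "nat list set" where
  "Comp = {\<alpha>. \<forall>a \<in> set \<alpha>. 0 < a}"

definition Comp_of :: "nat \<Rightarrow> nat list set" where
  "Comp_of n = {\<alpha> \<in> Comp. sum_list \<alpha> = n}"

text \<open>The set \<open>D(\<alpha>)\<close> of proper partial sums.\<close>
definition Dset :: "nat list \<Rightarrow> nat set" where
  "Dset \<alpha> = {sum_list (take i \<alpha>) | i. i \<in> {1..<length \<alpha>}}"


section \<open>Quasisymmetric functions\<close>

text \<open>\<open>monomial [i\<^sub>1,\<dots>,i\<^sub>k] [a\<^sub>1,\<dots>,a\<^sub>k]\<close> is the monomial with exponent \<open>a\<^sub>j\<close> at the variable with index \<open>i\<^sub>j\<close>.\<close>
definition monomial :: "nat list \<Rightarrow> nat list \<Rightarrow> nat multiset" where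
  "monomial is \<alpha> = (\<Sum>(i, a) \<leftarrow> zip is \<alpha>. replicate_mset a i)"

definition bounded_degree :: "'k::comm_ring_1 mps \<Rightarrow> bool" where
  "bounded_degree f \<longleftrightarrow> (\<exists>d. \<forall>m. d < size m \<longrightarrow> coeff f m = 0)"

definition quasisymmetric :: "'k::comm_ring_1 mps \<Rightarrow> bool" where
  "quasisymmetric f \<longleftrightarrow>
     (\<forall>\<alpha> \<in> Comp. \<forall>is js.
        sorted_wrt (<) is \<and> length is = length \<alpha> \<and> sorted_wrt (<) js \<and> length js = length \<alpha> \<longrightarrow>
        coeff f (monomial is \<alpha>) = coeff f (monomial js \<alpha>))"

lemma monomial_simps [simp]:
  "monomial [] \<alpha> = {#}" "monomial is [] = {#}"
  "monomial (i # is) (a # \<alpha>) = replicate_mset a i + monomial is \<alpha>"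
  by (simp_all add: monomial_def)

lemma image_mset_monomial: "image_mset \<phi> (monomial is \<alpha>) = monomial (map \<phi> is) \<alpha>"
proof (induction "is" \<alpha> rule: list_induct2')
qed simp_all

lemma set_monomial_subset: "set_mset (monomial is \<alpha>) \<subseteq> set is"
proof (induction "is" \<alpha> rule: list_induct2')
qed (auto split: if_splits)

lemma set_monomial: "\<alpha> \<in> Comp \<Longrightarrow> length is = length \<alpha> \<Longrightarrow> set_mset (monomial is \<alpha>) = set is"
proof (induction "is" \<alpha> rule: list_induct2')
qed (auto simp: Comp_def)

lemma size_monomial: "length is = length \<alpha> \<Longrightarrow> size (monomial is \<alpha>) = sum_list \<alpha>"
proof (induction "is" \<alpha> rule: list_induct2')
qed auto

lemma monomial_eq_iff:
  assumes "\<alpha> \<in> Comp" "\<beta> \<in> Comp" "length is = length \<alpha>" "length js = length \<beta>"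
    and "sorted_wrt (<) is" "sorted_wrt (<) js"
  shows "monomial is \<alpha> = monomial js \<beta> \<longleftrightarrow> is = js \<and> \<alpha> = \<beta>"
proof
  assume eq: "monomial is \<alpha> = monomial js \<beta>"
  then have "set is = set js" using assms by (metis set_monomial)
  then have ij: "is = js" using assms by (metis strict_sorted_equal)
  have "distinct is" using assms by (simp add: strict_sorted_iff)
  have "\<alpha> = \<beta>" using \<open>length is = length \<alpha>\<close> \<open>length js = length \<beta>\<close> eq \<open>distinct is\<close>
    unfolding ij [symmetric]
  proof (induction "is" arbitrary: \<alpha> \<beta>)
    case (Cons i "is")
    then obtain a \<alpha>' b \<beta>' where ab: "\<alpha> = a # \<alpha>'" "\<beta> = b # \<beta>'" by (metis length_Suc_conv)
    have i: "i \<notin># monomial is \<alpha>'" "i \<notin># monomial is \<beta>'"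
      using Cons.prems(4) set_monomial_subset by fastforce+
    have "count (monomial (i # is) \<alpha>) i = count (monomial (i # is) \<beta>) i" using Cons.prems by simp
    then have "a = b" using i by (simp add: ab not_in_iff)
    with Cons ab show ?case by simp
  qed simp
  with ij show "is = js \<and> \<alpha> = \<beta>" by simp
qed simp

lemma monomial_exists:
  obtains "is" \<alpha> where "sorted_wrt (<) is" "\<alpha> \<in> Comp" "length is = length \<alpha>" "m = monomial is \<alpha>"
proof
  let ?is = "sorted_list_of_set (set_mset m)"
  show "sorted_wrt (<) ?is" by simp
  show "map (count m) ?is \<in> Comp" by (auto simp: Comp_def)
  show "length ?is = length (map (count m) ?is)" by simp
  have "monomial ?is (map (count m) ?is) = (\<Sum>i\<leftarrow>?is. replicate_mset (count m i) i)"
    by (simp add: monomial_def zip_map2 zip_same_conv_map o_def)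
  also have "\<dots> = (\<Sum>i\<in>set_mset m. replicate_mset (count m i) i)"
    by (subst sum_list_distinct_conv_sum_set) auto
  also have "\<dots> = m"
  proof (rule multiset_eqI)
    fix x
    have "count (\<Sum>i\<in>set_mset m. replicate_mset (count m i) i) x
        = (\<Sum>i\<in>set_mset m. if i = x then count m x else 0)"
      by (auto simp: count_sum intro!: sum.cong)
    also have "\<dots> = count m x" by (simp add: not_in_iff)
    finally show "count (\<Sum>i\<in>set_mset m. replicate_mset (count m i) i) x = count m x" .
  qed
  finally show "m = monomial ?is (map (count m) ?is)" by simp
qed

lemma quasisymmetric_rename:
  assumes f: "quasisymmetric f" and \<phi>: "strict_mono_on (set_mset m) \<phi>"
  shows "coeff f (image_mset \<phi> m) = coeff f m"
proof -
  obtain "is" \<alpha> where m: "sorted_wrt (<) is" "\<alpha> \<in> Comp" "length is = length \<alpha>" "m = monomial is \<alpha>"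
    by (rule monomial_exists)
  have "set_mset m = set is" using m set_monomial by blast
  with \<phi> m(1) have "sorted_wrt (<) (map \<phi> is)"
    by (auto simp: sorted_wrt_map strict_mono_on_def intro: sorted_wrt_mono_rel [rotated])
  then have "coeff f (monomial (map \<phi> is) \<alpha>) = coeff f (monomial is \<alpha>)"
    using f m(1-3) unfolding quasisymmetric_def by (metis length_map)
  then show ?thesis by (simp only: m(4) image_mset_monomial)
qed

lemma quasisymmetricI:
  assumes "\<And>m \<phi>. strict_mono_on (set_mset m) \<phi> \<Longrightarrow> coeff f (image_mset \<phi> m) = coeff f m"
  shows "quasisymmetric f"
  unfolding quasisymmetric_def
proof (intro ballI allI impI, elim conjE)
  fix \<alpha> "is" js :: "nat list"
  assume a: "\<alpha> \<in> Comp" "sorted_wrt (<) is" "length is = length \<alpha>"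
    "sorted_wrt (<) js" "length js = length \<alpha>"
  define \<phi> where "\<phi> = the \<circ> map_of (zip is js)"
  have d: "distinct is" using a by (simp add: strict_sorted_iff)
  have n: "\<phi> (is ! k) = js ! k" if "k < length \<alpha>" for k
    using that a d by (simp add: \<phi>_def map_of_zip_nth)
  have "map \<phi> is = js" by (rule nth_equalityI) (use a n in auto)
  moreover have "strict_mono_on (set is) \<phi>"
  proof (rule strict_mono_onI)
    fix x y assume "x \<in> set is" "y \<in> set is" "x < y"
    then obtain k l where kl: "k < length is" "x = is ! k" "l < length is" "y = is ! l"
      by (metis in_set_conv_nth)
    with \<open>x < y\<close> a have "k < l"
      by (metis linorder_neqE_nat not_less_iff_gr_or_eq sorted_wrt_nth_less)
    with kl a n show "\<phi> x < \<phi> y" by (simp add: sorted_wrt_nth_less)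
  qed
  then have "strict_mono_on (set_mset (monomial is \<alpha>)) \<phi>"
    by (rule monotone_on_subset) (rule set_monomial_subset)
  ultimately show "coeff f (monomial is \<alpha>) = coeff f (monomial js \<alpha>)"
    using assms by (metis image_mset_monomial)
qed

lemma quasisymmetric_mult:
  assumes f: "quasisymmetric f" and g: "quasisymmetric g"
  shows "quasisymmetric (f * g)"
proof (rule quasisymmetricI)
  fix m \<phi> assume mono: "strict_mono_on (set_mset m) (\<phi> :: nat \<Rightarrow> nat)"
  then have inj: "inj_on \<phi> (set_mset m)" by (rule strict_mono_on_imp_inj_on)
  define \<psi> where "\<psi> = inv_into (set_mset m) \<phi>"
  have 1: "image_mset \<psi> (image_mset \<phi> a) = a" if "set_mset a \<subseteq> set_mset m" for a
  proof -
    have "image_mset \<psi> (image_mset \<phi> a) = image_mset (\<lambda>x. x) a"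
      unfolding multiset.map_comp
      by (rule image_mset_cong) (use that inj in \<open>auto simp: \<psi>_def\<close>)
    then show ?thesis by simp
  qed
  have 2: "image_mset \<phi> (image_mset \<psi> a) = a" if "set_mset a \<subseteq> \<phi> ` set_mset m" for a
  proof -
    have "image_mset \<phi> (image_mset \<psi> a) = image_mset (\<lambda>x. x) a"
      unfolding multiset.map_comp
      by (rule image_mset_cong) (use that in \<open>auto simp: \<psi>_def f_inv_into_f\<close>)
    then show ?thesis by simp
  qed
  have sub: "set_mset a \<subseteq> \<phi> ` set_mset m \<and> set_mset b \<subseteq> \<phi> ` set_mset m"
    if "a + b = image_mset \<phi> m" for a b
    using that by (metis set_image_mset set_mset_union sup_ge1 sup_ge2)
  show "coeff (f * g) (image_mset \<phi> m) = coeff (f * g) m"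
    unfolding times_mps.rep_eq
  proof (rule sum.reindex_bij_witness
      [where i = "\<lambda>(a, b). (image_mset \<phi> a, image_mset \<phi> b)"
         and j = "\<lambda>(a, b). (image_mset \<psi> a, image_mset \<psi> b)"], goal_cases)
    case (1 p)
    then obtain a b where p: "p = (a, b)" "a + b = image_mset \<phi> m" by blast
    then show ?case using 2 sub [OF p(2)] by simp
  next
    case (2 p)
    then obtain a b where p: "p = (a, b)" "a + b = image_mset \<phi> m" by blast
    then have "image_mset \<psi> a + image_mset \<psi> b = m" by (metis 1 image_mset_union order_refl)
    with p show ?case by simp
  next
    case (3 p)
    then obtain a b where p: "p = (a, b)" "a + b = m" by blast
    then have "set_mset a \<subseteq> set_mset m" "set_mset b \<subseteq> set_mset m" by auto
    then show ?case by (simp add: p(1) 1)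
  next
    case (4 p)
    then obtain a b where p: "p = (a, b)" "a + b = m" by blast
    then show ?case by (simp flip: image_mset_union)
  next
    case (5 p)
    then obtain a b where p: "p = (a, b)" "a + b = image_mset \<phi> m" by blast
    then have s: "image_mset \<psi> a + image_mset \<psi> b = m" by (metis 1 image_mset_union order_refl)
    then have "strict_mono_on (set_mset (image_mset \<psi> a)) \<phi>" "strict_mono_on (set_mset (image_mset \<psi> b)) \<phi>"
      using mono by (metis monotone_on_subset set_mset_union sup_ge1 sup_ge2)+
    then have "coeff f (image_mset \<psi> a) = coeff f a" "coeff g (image_mset \<psi> b) = coeff g b"
      using f g p 2 sub by (metis quasisymmetric_rename)+
    with p show ?case by simp
  qed
qed

lemma bounded_degree_mult:
  assumes "bounded_degree f" "bounded_degree g"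
  shows "bounded_degree (f * g)"
proof -
  obtain d where d: "\<forall>m. d < size m \<longrightarrow> coeff f m = 0"
    using assms(1) unfolding bounded_degree_def by (rule exE)
  obtain e where e: "\<forall>m. e < size m \<longrightarrow> coeff g m = 0"
    using assms(2) unfolding bounded_degree_def by (rule exE)
  have "coeff (f * g) m = 0" if "d + e < size m" for m
    unfolding times_mps.rep_eq
  proof (rule sum.neutral, intro ballI)
    fix p assume "p \<in> {(a, b). a + b = m}"
    then obtain a b where p: "p = (a, b)" "a + b = m" by blast
    then have "size a + size b = size m" by (metis size_union)
    then have "d < size a \<or> e < size b" using that by linarith
    then show "(case p of (a, b) \<Rightarrow> coeff f a * coeff g b) = 0" using d e p by auto
  qed
  then show ?thesis unfolding bounded_degree_def by blast
qed

lemma bounded_degree_add: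
  assumes "bounded_degree f" "bounded_degree g"
  shows "bounded_degree (f + g)"
proof -
  obtain d where d: "\<forall>m. d < size m \<longrightarrow> coeff f m = 0"
    using assms(1) unfolding bounded_degree_def by (rule exE)
  obtain e where e: "\<forall>m. e < size m \<longrightarrow> coeff g m = 0"
    using assms(2) unfolding bounded_degree_def by (rule exE)
  have "\<forall>m. max d e < size m \<longrightarrow> coeff (f + g) m = 0" using d e by (simp add: plus_mps.rep_eq)
  then show ?thesis unfolding bounded_degree_def by blast
qed

lemma bounded_degree_scale: "bounded_degree f \<Longrightarrow> bounded_degree (mps_scale c f)"
  unfolding bounded_degree_def mps_scale.rep_eq by (erule ex_forward) simp

lemma bounded_degree_uminus: "bounded_degree f \<Longrightarrow> bounded_degree (- f)"
  unfolding bounded_degree_def uminus_mps.rep_eq by (erule ex_forward) simp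

lemma bounded_degree_one: "bounded_degree 1"
proof -
  have "\<forall>m. 0 < size m \<longrightarrow> coeff 1 m = 0" by (auto simp: one_mps.rep_eq)
  then show ?thesis unfolding bounded_degree_def by (rule exI)
qed

lemma quasisymmetric_one: "quasisymmetric 1"
  by (rule quasisymmetricI) (simp add: one_mps.rep_eq)

lemma quasisymmetric_add: "quasisymmetric f \<Longrightarrow> quasisymmetric g \<Longrightarrow> quasisymmetric (f + g)"
  by (rule quasisymmetricI) (simp add: plus_mps.rep_eq quasisymmetric_rename)

lemma quasisymmetric_uminus: "quasisymmetric f \<Longrightarrow> quasisymmetric (- f)"
  by (rule quasisymmetricI) (simp add: uminus_mps.rep_eq quasisymmetric_rename)

lemma quasisymmetric_scale: "quasisymmetric f \<Longrightarrow> quasisymmetric (mps_scale c f)"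
  by (rule quasisymmetricI) (simp add: mps_scale.rep_eq quasisymmetric_rename)

typedef (overloaded) 'k qsym = "{f :: 'k::comm_ring_1 mps. bounded_degree f \<and> quasisymmetric f}"
  morphisms mps_of Abs_qsym
  by (rule exI [of _ 0]) (simp add: bounded_degree_def quasisymmetric_def zero_mps.rep_eq)

setup_lifting type_definition_qsym

instantiation qsym :: (comm_ring_1) comm_ring_1
begin

lift_definition zero_qsym :: "'a qsym" is 0
  by (simp add: bounded_degree_def quasisymmetric_def zero_mps.rep_eq)
lift_definition one_qsym :: "'a qsym" is 1
  by (simp add: bounded_degree_one quasisymmetric_one)
lift_definition plus_qsym :: "'a qsym \<Rightarrow> 'a qsym \<Rightarrow> 'a qsym" is "(+)"
  by (simp add: bounded_degree_add quasisymmetric_add)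
lift_definition uminus_qsym :: "'a qsym \<Rightarrow> 'a qsym" is uminus
  by (simp add: bounded_degree_uminus quasisymmetric_uminus)
lift_definition minus_qsym :: "'a qsym \<Rightarrow> 'a qsym \<Rightarrow> 'a qsym" is "(-)"
  by (metis bounded_degree_add bounded_degree_uminus diff_conv_add_uminus
      quasisymmetric_add quasisymmetric_uminus)
lift_definition times_qsym :: "'a qsym \<Rightarrow> 'a qsym \<Rightarrow> 'a qsym" is "(*)"
  by (simp add: bounded_degree_mult quasisymmetric_mult)

instance
  by standard (transfer; simp add: algebra_simps)+

end

lift_definition qsym_scale :: "'k::comm_ring_1 \<Rightarrow> 'k qsym \<Rightarrow> 'k qsym" (infixr "*\<^sub>Q" 75)
  is mps_scale
  by (simp add: bounded_degree_scale quasisymmetric_scale)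

global_interpretation qsym: module "qsym_scale :: 'k::comm_ring_1 \<Rightarrow> 'k qsym \<Rightarrow> 'k qsym"
  defines qsym_span = qsym.span and qsym_subspace = qsym.subspace
  by standard
     (transfer, rule mps_eqI, simp add: mps_scale.rep_eq plus_mps.rep_eq algebra_simps)+


subsection \<open>The monomial basis\<close>

text \<open>
  The coefficient of a monomial \<open>m\<close> in the defining sum of \<open>M\<^sub>\<alpha>\<close> counts the sequences
  \<open>i\<^sub>1 < \<dots> < i\<^sub>\<ell>\<close> giving \<open>m\<close>; by \<open>monomial_eq_iff\<close> there is at most one.
  \<open>M_basis \<alpha>\<close> is set to 0 if \<open>\<alpha>\<close> is not a composition.
\<close>
lift_definition M_basis :: "nat list \<Rightarrow> 'k::comm_ring_1 qsym"
  is "\<lambda>\<alpha>. Abs_mps (\<lambda>m. of_bool (\<alpha> \<in> Comp \<and>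
        (\<exists>is. sorted_wrt (<) is \<and> length is = length \<alpha> \<and> m = monomial is \<alpha>)))"
proof
  fix \<alpha>
  let ?P = "\<lambda>m. \<alpha> \<in> Comp \<and> (\<exists>is. sorted_wrt (<) is \<and> length is = length \<alpha> \<and> m = monomial is \<alpha>)"
  show "bounded_degree (Abs_mps (\<lambda>m. of_bool (?P m)) :: 'k mps)"
    unfolding bounded_degree_def
    by (rule exI [of _ "sum_list \<alpha>"]) (auto simp: Abs_mps_inverse size_monomial)
  show "quasisymmetric (Abs_mps (\<lambda>m. of_bool (?P m)) :: 'k mps)"
    unfolding quasisymmetric_def
  proof (intro ballI allI impI, elim conjE)
    fix \<beta> "is" js :: "nat list"
    assume "\<beta> \<in> Comp" "sorted_wrt (<) is" "length is = length \<beta>" "sorted_wrt (<) js" "length js = length \<beta>"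
    then have "?P (monomial is \<beta>) = ?P (monomial js \<beta>)"
      using monomial_eq_iff [of \<beta> \<alpha>] by metis
    then show "coeff (Abs_mps (\<lambda>m. of_bool (?P m)) :: 'k mps) (monomial is \<beta>) =
        coeff (Abs_mps (\<lambda>m. of_bool (?P m))) (monomial js \<beta>)"
      by (simp add: Abs_mps_inverse)
  qed
qed

text \<open>
  The coordinate of \<open>f\<close> at \<open>M\<^sub>\<alpha>\<close>, read off at the monomial \<open>x\<^sub>1\<^bsup>\<alpha>\<^sub>1\<^esup> x\<^sub>2\<^bsup>\<alpha>\<^sub>2\<^esup> \<cdots>\<close>.
\<close>
definition M_coord :: "'k::comm_ring_1 qsym \<Rightarrow> nat list \<Rightarrow> 'k" where
  "M_coord f \<alpha> = coeff (mps_of f) (monomial [0..<length \<alpha>] \<alpha>)"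

definition M_supp :: "'k::comm_ring_1 qsym \<Rightarrow> nat list set" where
  "M_supp f = {\<alpha> \<in> Comp. M_coord f \<alpha> \<noteq> 0}"

lemma M_coord_M: "\<alpha> \<in> Comp \<Longrightarrow> \<beta> \<in> Comp \<Longrightarrow> M_coord (M_basis \<alpha>) \<beta> = of_bool (\<alpha> = \<beta>)"
proof -
  assume a: "\<alpha> \<in> Comp" "\<beta> \<in> Comp"
  have "(\<exists>is. sorted_wrt (<) is \<and> length is = length \<alpha> \<and> monomial [0..<length \<beta>] \<beta> = monomial is \<alpha>)
      \<longleftrightarrow> \<alpha> = \<beta>"
    using monomial_eq_iff [of \<beta> \<alpha> "[0..<length \<beta>]"] a
    by (metis length_upt minus_nat.diff_0 strict_sorted_iff sorted_upt distinct_upt)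
  with a show ?thesis by (simp add: M_coord_def M_basis.rep_eq Abs_mps_inverse)
qed

lemma M_coord_add: "M_coord (f + g) \<alpha> = M_coord f \<alpha> + M_coord g \<alpha>"
  by (simp add: M_coord_def plus_qsym.rep_eq plus_mps.rep_eq)

lemma M_coord_scale: "M_coord (c *\<^sub>Q f) \<alpha> = c * M_coord f \<alpha>"
  by (simp add: M_coord_def qsym_scale.rep_eq mps_scale.rep_eq)

lemma M_coord_0: "M_coord 0 \<alpha> = 0"
  by (simp add: M_coord_def zero_qsym.rep_eq zero_mps.rep_eq)

lemma M_coord_sum: "M_coord (sum F A) \<alpha> = (\<Sum>x\<in>A. M_coord (F x) \<alpha>)"
  by (induction A rule: infinite_finite_induct) (simp_all add: M_coord_0 M_coord_add)

lemma coeff_eq_M_coord: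
  assumes "sorted_wrt (<) is" "\<alpha> \<in> Comp" "length is = length \<alpha>"
  shows "coeff (mps_of f) (monomial is \<alpha>) = M_coord f \<alpha>"
proof -
  have "quasisymmetric (mps_of f)" using mps_of by blast
  then show ?thesis unfolding M_coord_def quasisymmetric_def using assms
    by (metis length_upt minus_nat.diff_0 strict_sorted_iff sorted_upt distinct_upt)
qed

lemma qsym_eqI: "(\<And>\<alpha>. \<alpha> \<in> Comp \<Longrightarrow> M_coord f \<alpha> = M_coord g \<alpha>) \<Longrightarrow> f = g"
proof -
  assume *: "\<And>\<alpha>. \<alpha> \<in> Comp \<Longrightarrow> M_coord f \<alpha> = M_coord g \<alpha>"
  have "mps_of f = mps_of g"
  proof (rule mps_eqI)
    fix m
    show "coeff (mps_of f) m = coeff (mps_of g) m"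
      by (rule monomial_exists [of m]) (metis * coeff_eq_M_coord)
  qed
  then show ?thesis by (simp add: mps_of_inject)
qed

lemma length_le_sum_list: "\<alpha> \<in> Comp \<Longrightarrow> length \<alpha> \<le> sum_list \<alpha>"
  by (induction \<alpha>) (auto simp: Comp_def)

lemma finite_Comp_le: "finite {\<alpha> \<in> Comp. sum_list \<alpha> \<le> d}"
proof (rule finite_subset)
  show "{\<alpha> \<in> Comp. sum_list \<alpha> \<le> d} \<subseteq> {xs. set xs \<subseteq> {..d} \<and> length xs \<le> d}"
    using length_le_sum_list by (force dest: member_le_sum_list)
  show "finite {xs. set xs \<subseteq> {..d} \<and> length xs \<le> d}"
    by (rule finite_lists_length_le) simp
qed

lemma finite_M_supp [simp]: "finite (M_supp f)"
proof -
  have "bounded_degree (mps_of f)" using mps_of by blast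
  then obtain d where "\<forall>m. d < size m \<longrightarrow> coeff (mps_of f) m = 0"
    unfolding bounded_degree_def by (rule exE)
  then have "M_supp f \<subseteq> {\<alpha> \<in> Comp. sum_list \<alpha> \<le> d}"
    by (auto simp: M_supp_def M_coord_def) (metis length_upt minus_nat.diff_0 not_le size_monomial)
  then show ?thesis using finite_Comp_le finite_subset by blast
qed

lemma M_expansion: "f = (\<Sum>\<alpha> \<in> M_supp f. M_coord f \<alpha> *\<^sub>Q M_basis \<alpha>)"
proof (rule qsym_eqI)
  fix \<beta> assume b: "\<beta> \<in> Comp"
  have "M_coord (\<Sum>\<alpha> \<in> M_supp f. M_coord f \<alpha> *\<^sub>Q M_basis \<alpha>) \<beta>
      = (\<Sum>\<alpha> \<in> M_supp f. M_coord f \<alpha> * M_coord (M_basis \<alpha>) \<beta>)"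
    by (simp add: M_coord_sum M_coord_scale)
  also have "\<dots> = (\<Sum>\<alpha> \<in> M_supp f. if \<alpha> = \<beta> then M_coord f \<beta> else 0)"
    by (rule sum.cong) (auto simp: M_coord_M b M_supp_def)
  also have "\<dots> = (if \<beta> \<in> M_supp f then M_coord f \<beta> else 0)"
    by (rule sum.delta) simp
  also have "\<dots> = M_coord f \<beta>" using b by (simp add: M_supp_def)
  finally show "M_coord f \<beta> = M_coord (\<Sum>\<alpha> \<in> M_supp f. M_coord f \<alpha> *\<^sub>Q M_basis \<alpha>) \<beta>" by simp
qed


section \<open>The tensor square of QSym\<close>

text \<open>
  \<open>QSym \<otimes> QSym\<close> is the free module on the pairs of elements of QSym (formal sums of pairs,
  as finitely supported functions) modulo the bilinearity relations.
\<close>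

definition formal_scale :: "'k::comm_ring_1 \<Rightarrow> ('b \<Rightarrow>\<^sub>0 'k) \<Rightarrow> ('b \<Rightarrow>\<^sub>0 'k)" where
  "formal_scale c u = Poly_Mapping.map ((*) c) u"

lemma lookup_formal_scale: "Poly_Mapping.lookup (formal_scale c u) x = c * Poly_Mapping.lookup u x"
  by (simp add: formal_scale_def Poly_Mapping.map.rep_eq when_def)

global_interpretation formal: module "formal_scale :: 'k::comm_ring_1 \<Rightarrow> ('b \<Rightarrow>\<^sub>0 'k) \<Rightarrow> ('b \<Rightarrow>\<^sub>0 'k)"
  defines formal_span = formal.span
  by standard (rule poly_mapping_eqI, simp add: lookup_formal_scale lookup_add algebra_simps)+

abbreviation pair :: "'k::comm_ring_1 qsym \<Rightarrow> 'k qsym \<Rightarrow> ('k qsym \<times> 'k qsym) \<Rightarrow>\<^sub>0 'k" where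
  "pair f g \<equiv> Poly_Mapping.single (f, g) 1"

definition bilinear_relators :: "(('k::comm_ring_1 qsym \<times> 'k qsym) \<Rightarrow>\<^sub>0 'k) set" where
  "bilinear_relators =
     {pair (f + f') g - pair f g - pair f' g | f f' g. True} \<union>
     {pair f (g + g') - pair f g - pair f g' | f g g'. True} \<union>
     {pair (c *\<^sub>Q f) g - formal_scale c (pair f g) | c f g. True} \<union>
     {pair f (c *\<^sub>Q g) - formal_scale c (pair f g) | c f g. True}"

definition tensor_rel ::
    "(('k::comm_ring_1 qsym \<times> 'k qsym) \<Rightarrow>\<^sub>0 'k) \<Rightarrow> (('k qsym \<times> 'k qsym) \<Rightarrow>\<^sub>0 'k) \<Rightarrow> bool" where
  "tensor_rel u v \<longleftrightarrow> u - v \<in> formal_span bilinear_relators"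

lemma equivp_tensor_rel:
  "equivp (tensor_rel :: (('k::comm_ring_1 qsym \<times> 'k qsym) \<Rightarrow>\<^sub>0 'k) \<Rightarrow> _ \<Rightarrow> bool)"
  (is "equivp ?R")
proof (rule equivpI)
  show "reflp ?R" by (simp add: reflp_def tensor_rel_def formal.span_zero)
  show "symp ?R"
    unfolding symp_def tensor_rel_def by (metis formal.span_neg minus_diff_eq)
  show "transp ?R"
  proof (rule transpI)
    fix u v w :: "('k qsym \<times> 'k qsym) \<Rightarrow>\<^sub>0 'k"
    assume "?R u v" "?R v w"
    then have "(u - v) + (v - w) \<in> formal_span bilinear_relators"
      unfolding tensor_rel_def by (rule formal.span_add)
    then show "?R u w" by (simp add: tensor_rel_def)
  qed
qed

quotient_type (overloaded) 'k qsym_tensor = "('k::comm_ring_1 qsym \<times> 'k qsym) \<Rightarrow>\<^sub>0 'k" / tensor_rel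
  by (rule equivp_tensor_rel)

instantiation qsym_tensor :: (comm_ring_1) ab_group_add
begin

lift_definition zero_qsym_tensor :: "'a qsym_tensor" is 0 .
lift_definition plus_qsym_tensor :: "'a qsym_tensor \<Rightarrow> 'a qsym_tensor \<Rightarrow> 'a qsym_tensor" is "(+)"
proof -
  fix u u' v v' :: "('a qsym \<times> 'a qsym) \<Rightarrow>\<^sub>0 'a"
  assume "tensor_rel u u'" "tensor_rel v v'"
  then have "(u - u') + (v - v') \<in> formal_span bilinear_relators"
    unfolding tensor_rel_def by (rule formal.span_add)
  then show "tensor_rel (u + v) (u' + v')" by (simp add: tensor_rel_def algebra_simps)
qed
lift_definition uminus_qsym_tensor :: "'a qsym_tensor \<Rightarrow> 'a qsym_tensor" is uminus
proof -
  fix u u' :: "('a qsym \<times> 'a qsym) \<Rightarrow>\<^sub>0 'a"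
  assume "tensor_rel u u'"
  then have "- (u - u') \<in> formal_span bilinear_relators"
    unfolding tensor_rel_def by (rule formal.span_neg)
  then show "tensor_rel (- u) (- u')" by (simp add: tensor_rel_def)
qed
lift_definition minus_qsym_tensor :: "'a qsym_tensor \<Rightarrow> 'a qsym_tensor \<Rightarrow> 'a qsym_tensor" is "(-)"
proof -
  fix u u' v v' :: "('a qsym \<times> 'a qsym) \<Rightarrow>\<^sub>0 'a"
  assume "tensor_rel u u'" "tensor_rel v v'"
  then have "(u - u') - (v - v') \<in> formal_span bilinear_relators"
    unfolding tensor_rel_def by (rule formal.span_diff)
  then show "tensor_rel (u - v) (u' - v')" by (simp add: tensor_rel_def algebra_simps)
qed

instance
proof
  fix a b c :: "'a qsym_tensor"
  show "a + b + c = a + (b + c)"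
    by transfer (simp add: tensor_rel_def formal.span_zero algebra_simps)
  show "a + b = b + a" by transfer (simp add: tensor_rel_def formal.span_zero algebra_simps)
  show "0 + a = a" by transfer (simp add: tensor_rel_def formal.span_zero)
  show "- a + a = 0" by transfer (simp add: tensor_rel_def formal.span_zero)
  show "a - b = a + - b" by transfer (simp add: tensor_rel_def formal.span_zero)
qed

end

lift_definition tensor_scale :: "'k::comm_ring_1 \<Rightarrow> 'k qsym_tensor \<Rightarrow> 'k qsym_tensor"
  is formal_scale
  unfolding tensor_rel_def formal.scale_right_diff_distrib [symmetric]
  by (rule formal.span_scale)

global_interpretation tensor: module "tensor_scale :: 'k::comm_ring_1 \<Rightarrow> 'k qsym_tensor \<Rightarrow> 'k qsym_tensor"
  defines tensor_span = tensor.span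
  by standard (transfer, simp add: tensor_rel_def formal.span_zero algebra_simps)+

lift_definition tensor :: "'k::comm_ring_1 qsym \<Rightarrow> 'k qsym \<Rightarrow> 'k qsym_tensor" (infixl "\<otimes>\<^sub>Q" 70)
  is pair .

lemma tensor_bilinear:
  "(f + f') \<otimes>\<^sub>Q g = f \<otimes>\<^sub>Q g + f' \<otimes>\<^sub>Q g"
  "f \<otimes>\<^sub>Q (g + g') = f \<otimes>\<^sub>Q g + f \<otimes>\<^sub>Q g'"
  "(c *\<^sub>Q f) \<otimes>\<^sub>Q g = tensor_scale c (f \<otimes>\<^sub>Q g)"
  "f \<otimes>\<^sub>Q (c *\<^sub>Q g) = tensor_scale c (f \<otimes>\<^sub>Q g)"
  by (transfer, unfold tensor_rel_def diff_diff_eq [symmetric], rule formal.span_base,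
      unfold bilinear_relators_def, blast)+


section \<open>Coproduct and antipode\<close>

text \<open>
  Linear extensions of maps given on the basis \<open>(M\<^sub>\<alpha>)\<close>; they are characterised by the
  lemmas \<open>coproduct_hom\<close>, \<open>coproduct_M\<close>, \<open>antipode_hom\<close>, \<open>antipode_M\<close>, \<open>M_expansion\<close>.
\<close>

definition coproduct_M_val :: "nat list \<Rightarrow> 'k::comm_ring_1 qsym_tensor" where
  "coproduct_M_val \<alpha> = (\<Sum>(\<beta>, \<gamma>) \<in> {(\<beta>, \<gamma>). \<beta> @ \<gamma> = \<alpha>}. M_basis \<beta> \<otimes>\<^sub>Q M_basis \<gamma>)"

definition antipode_M_val :: "nat list \<Rightarrow> 'k::comm_ring_1 qsym" where
  "antipode_M_val \<alpha> =
     (-1) ^ length \<alpha> *\<^sub>Q (\<Sum>\<gamma> \<in> {\<gamma> \<in> Comp_of (sum_list \<alpha>). Dset \<gamma> \<subseteq> Dset (rev \<alpha>)}. M_basis \<gamma>)"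

definition coproduct :: "'k::comm_ring_1 qsym \<Rightarrow> 'k qsym_tensor" where
  "coproduct f = (\<Sum>\<alpha> \<in> M_supp f. tensor_scale (M_coord f \<alpha>) (coproduct_M_val \<alpha>))"

definition antipode :: "'k::comm_ring_1 qsym \<Rightarrow> 'k qsym" where
  "antipode f = (\<Sum>\<alpha> \<in> M_supp f. M_coord f \<alpha> *\<^sub>Q antipode_M_val \<alpha>)"

lemma linear_extension:
  fixes s :: "'k::comm_ring_1 \<Rightarrow> 'b::ab_group_add \<Rightarrow> 'b"
  assumes "module s"
  defines "L \<equiv> \<lambda>F f. \<Sum>\<alpha> \<in> M_supp f. s (M_coord f \<alpha>) (F \<alpha>)"
  shows "module_hom qsym_scale s (L F)" "\<alpha> \<in> Comp \<Longrightarrow> L F (M_basis \<alpha>) = F \<alpha>"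
proof -
  interpret s: module s by fact
  have ext: "L F f = (\<Sum>\<alpha> \<in> A. s (M_coord f \<alpha>) (F \<alpha>))" if "M_supp f \<subseteq> A" "A \<subseteq> Comp" "finite A" for f A
    unfolding L_def by (rule sum.mono_neutral_left) (use that in \<open>auto simp: M_supp_def\<close>)
  have c: "M_supp f \<subseteq> Comp" for f :: "'k qsym" by (auto simp: M_supp_def)
  show "module_hom qsym_scale s (L F)"
    unfolding module_hom_iff
  proof (intro conjI allI)
    fix f g :: "'k qsym" and r
    have "M_supp (f + g) \<subseteq> M_supp f \<union> M_supp g" by (auto simp: M_supp_def M_coord_add)
    then have "L F h = (\<Sum>\<alpha> \<in> M_supp f \<union> M_supp g. s (M_coord h \<alpha>) (F \<alpha>))"
      if "h \<in> {f, g, f + g}" for h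
      by (intro ext) (use that c in auto)
    then show "L F (f + g) = L F f + L F g"
      by (simp add: M_coord_add s.scale_left_distrib sum.distrib)
    have "M_supp (r *\<^sub>Q f) \<subseteq> M_supp f" by (auto simp: M_supp_def M_coord_scale)
    then have "L F (r *\<^sub>Q f) = (\<Sum>\<alpha> \<in> M_supp f. s (M_coord (r *\<^sub>Q f) \<alpha>) (F \<alpha>))"
      by (intro ext) (use c in auto)
    then show "L F (r *\<^sub>Q f) = s r (L F f)"
      by (simp add: L_def M_coord_scale s.scale_sum_right)
  qed (use qsym.module_axioms s.module_axioms in auto)
  assume a: "\<alpha> \<in> Comp"
  then have "L F (M_basis \<alpha>) = (\<Sum>\<beta> \<in> {\<alpha>}. s (M_coord (M_basis \<alpha>) \<beta>) (F \<beta>))"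
    by (intro ext) (auto simp: M_supp_def M_coord_M split: if_splits)
  with a show "L F (M_basis \<alpha>) = F \<alpha>" by (simp add: M_coord_M)
qed

lemma coproduct_hom: "module_hom qsym_scale tensor_scale coproduct"
  using linear_extension(1) [OF tensor.module_axioms] unfolding coproduct_def [abs_def] .

lemma coproduct_M:
  "\<alpha> \<in> Comp \<Longrightarrow> coproduct (M_basis \<alpha>) = (\<Sum>(\<beta>, \<gamma>) \<in> {(\<beta>, \<gamma>). \<beta> @ \<gamma> = \<alpha>}. M_basis \<beta> \<otimes>\<^sub>Q M_basis \<gamma>)"
  using linear_extension(2) [OF tensor.module_axioms, of \<alpha> coproduct_M_val]
  unfolding coproduct_def coproduct_M_val_def by blast

lemma antipode_hom: "module_hom qsym_scale qsym_scale antipode"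
  using linear_extension(1) [OF qsym.module_axioms] unfolding antipode_def [abs_def] .

lemma antipode_M:
  "\<alpha> \<in> Comp_of n \<Longrightarrow>
    antipode (M_basis \<alpha>) = (-1) ^ length \<alpha> *\<^sub>Q (\<Sum>\<gamma> \<in> {\<gamma> \<in> Comp_of n. Dset \<gamma> \<subseteq> Dset (rev \<alpha>)}. M_basis \<gamma>)"
  using linear_extension(2) [OF qsym.module_axioms, of \<alpha> antipode_M_val]
  unfolding antipode_def antipode_M_val_def by (simp add: Comp_of_def)


section \<open>Hopf subalgebras\<close>

text \<open>
  The image of the canonical map \<open>D \<otimes> D \<rightarrow> QSym \<otimes> QSym\<close> is the span of the pure tensors
  \<open>f \<otimes> g\<close> with \<open>f, g \<in> D\<close>; the map itself need not be injective.
\<close>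
definition subcoalgebra :: "'k::comm_ring_1 qsym set \<Rightarrow> bool" where
  "subcoalgebra D \<longleftrightarrow>
     qsym_subspace D \<and> coproduct ` D \<subseteq> tensor_span {f \<otimes>\<^sub>Q g | f g. f \<in> D \<and> g \<in> D}"

definition subalgebra :: "'k::comm_ring_1 qsym set \<Rightarrow> bool" where
  "subalgebra D \<longleftrightarrow> qsym_subspace D \<and> 1 \<in> D \<and> (\<forall>f \<in> D. \<forall>g \<in> D. f * g \<in> D)"

definition hopf_subalgebra :: "'k::comm_ring_1 qsym set \<Rightarrow> bool" where
  "hopf_subalgebra D \<longleftrightarrow> subalgebra D \<and> subcoalgebra D \<and> antipode ` D \<subseteq> D"


section \<open>The enriched q-monomial functions\<close>

definition eta :: "'k::comm_ring_1 \<Rightarrow> nat list \<Rightarrow> 'k qsym" where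
  "eta q \<alpha> = (\<Sum>\<beta> \<in> {\<beta> \<in> Comp_of (sum_list \<alpha>). Dset \<beta> \<subseteq> Dset \<alpha>}. (q + 1) ^ length \<beta> *\<^sub>Q M_basis \<beta>)"

definition QSym_on :: "'k::comm_ring_1 \<Rightarrow> nat list set \<Rightarrow> 'k qsym set" where
  "QSym_on q T = qsym_span (eta q ` T)"

end

theory Submission
  imports Defs "HOL-Computational_Algebra.Polynomial"
begin

text \<open>
  Write \<open>r = q + 1\<close> and let \<open>\<eta>\<^sub>w\<close> be the enriched monomial function of a word \<open>w\<close>.  The claim reduces to
  three expansions of \<open>\<eta>\<close>-functions with letters in \<open>Y\<close>.  The coproduct is just deconcatenation,
  \<open>\<Delta> \<eta>\<^sub>\<alpha> = \<Sum> \<eta>\<^sub>v \<otimes> \<eta>\<^sub>w\<close> over \<open>vw = \<alpha>\<close> (\<open>coproduct_eta\<close>), because cutting a coarsening of \<open>\<alpha>\<close> in two is the same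
  as cutting \<open>\<alpha>\<close> and coarsening both pieces.  For the product and the antipode one needs that every letter that
  arises is a sum of letters of the given words; this is where closure of \<open>Y\<close> under addition enters.

  The first block of a coarsening of \<open>xw\<close> may absorb any initial part of \<open>w\<close>, so \<open>\<eta>\<^sub>x\<^sub>w\<close> is assembled from the
  \<open>\<eta>\<close>-functions of all suffixes of \<open>w\<close>.  One therefore keeps track of all suffixes at once: put
  \<open>P\<^sub>w = \<Sum> t\<^bsup>|u|\<^esup> \<eta>\<^sub>v\<close>, the sum being over \<open>uv = w\<close>, a polynomial over QSym with constant coefficient \<open>\<eta>\<^sub>w\<close>
  (\<open>eta_poly\<close>).  The operator \<open>front\<close> turns the auxiliary variable \<open>t\<close> into a new smallest variable, in every
  possible way; it satisfies a Rota--Baxter identity (\<open>front_mult\<close>), which is the recursion of the quasi-shuffle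
  product in disguise.  On polynomials there is a linear map \<open>glue r x\<close> with \<open>P\<^sub>w \<mapsto> P\<^sub>x\<^sub>w\<close>, and applied after
  removal of the constant coefficient it maps \<open>P\<^sub>y\<^sub>w \<mapsto> P\<^sub>v\<close> where \<open>v\<close> is \<open>yw\<close> with \<open>x\<close> added to its first letter.
  So the span of the \<open>P\<^sub>w\<close> with \<open>w \<in> Y\<^sup>*\<close> is stable under both operations for \<open>x \<in> Y\<close>, and everything else
  follows by recursion inside this span:

  \<^item> the product of QSym lifts to a commutative product on polynomials for which the product of two glued
    polynomials is a combination of glued products of shorter ones (\<open>twisted_mult_glue\<close>);
  \<^item> the antipode of \<open>\<eta>\<^sub>\<alpha>\<close> is the constant coefficient of a polynomial built from the reversal of \<open>\<alpha>\<close>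
    by these two operations (\<open>antipode_eta_eq_coeff\<close>).

  Taking constant coefficients gives the result.
\<close>

section \<open>Turning an auxiliary variable into the smallest variable\<close>

abbreviation mcoeff :: "'k::comm_ring_1 qsym \<Rightarrow> nat multiset \<Rightarrow> 'k" where
  "mcoeff f m \<equiv> Defs.coeff (mps_of f) m"

abbreviation rest :: "nat multiset \<Rightarrow> nat multiset" where
  "rest m \<equiv> {#j \<in># m. j \<noteq> Min (set_mset m)#}"

text \<open>
  For a sequence \<open>p\<close>, thought of as the series \<open>\<Sum> p\<^sub>n t\<^sup>n\<close>, this is the sum over all \<open>i\<close> and all \<open>n > 0\<close> of
  \<open>x\<^sub>i\<^sup>n p\<^sub>n(x\<^sub>i\<^sub>+\<^sub>1, x\<^sub>i\<^sub>+\<^sub>2, \<dots>)\<close>: a nonempty monomial determines \<open>i\<close> as its smallest variable and \<open>n\<close> as the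
  exponent of that variable.
\<close>
definition front_mps :: "(nat \<Rightarrow> 'k::comm_ring_1 mps) \<Rightarrow> 'k mps" where
  "front_mps p = Abs_mps (\<lambda>m. if m = {#} then 0
     else Defs.coeff (p (count m (Min (set_mset m)))) (rest m))"

lemma coeff_front_mps:
  "Defs.coeff (front_mps p) m =
     (if m = {#} then 0 else Defs.coeff (p (count m (Min (set_mset m)))) (rest m))"
  by (simp add: front_mps_def Abs_mps_inverse)

lemma split_mset_at: "m = replicate_mset (count m i) i + {#j \<in># m. j \<noteq> i#}"
  by (rule multiset_eqI) auto

lemma bounded_degree_front:
  assumes bd: "\<And>n. bounded_degree (p n)" and z: "\<And>n. N < n \<Longrightarrow> p n = 0"
  shows "bounded_degree (front_mps p)"
proof -
  have "\<forall>n. \<exists>d. \<forall>m. d < size m \<longrightarrow> Defs.coeff (p n) m = 0"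
    using bd unfolding bounded_degree_def by blast
  then obtain d where d: "\<And>n m. d n < size m \<Longrightarrow> Defs.coeff (p n) m = 0" by metis
  have "Defs.coeff (front_mps p) m = 0" if m: "N + (\<Sum>n\<le>N. d n) < size m" for m
  proof -
    define i where "i = Min (set_mset m)"
    define n where "n = count m i"
    have s: "size m = n + size {#j \<in># m. j \<noteq> i#}"
      unfolding n_def by (subst split_mset_at[of m i]) (simp only: size_union size_replicate_mset)
    have "Defs.coeff (p n) {#j \<in># m. j \<noteq> i#} = 0"
    proof (cases "n \<le> N")
      case True
      then have "d n \<le> (\<Sum>n\<le>N. d n)" by (intro member_le_sum) auto
      then show ?thesis using m s True by (intro d) linarith
    next
      case False
      then show ?thesis by (simp add: z zero_mps.rep_eq)
    qed
    then show ?thesis by (simp add: coeff_front_mps i_def n_def)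
  qed
  then show ?thesis unfolding bounded_degree_def by blast
qed

text \<open>
  An order-preserving renaming of variables preserves the smallest variable and its exponent.
\<close>
lemma quasisymmetric_front:
  assumes q: "\<And>n. quasisymmetric (p n)"
  shows "quasisymmetric (front_mps p)"
proof (rule quasisymmetricI)
  fix m and \<phi> :: "nat \<Rightarrow> nat" assume mono: "strict_mono_on (set_mset m) \<phi>"
  show "Defs.coeff (front_mps p) (image_mset \<phi> m) = Defs.coeff (front_mps p) m"
  proof (cases "m = {#}")
    case False
    define i where "i = Min (set_mset m)"
    have i: "i \<in># m" and le: "\<And>j. j \<in># m \<Longrightarrow> i \<le> j" using False by (auto simp: i_def)
    have inj: "inj_on \<phi> (set_mset m)" using mono by (rule strict_mono_on_imp_inj_on)
    have Mi: "Min (\<phi> ` set_mset m) = \<phi> i"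
      using i le mono by (intro Min_eqI) (auto simp: strict_mono_on_leD)
    have eq: "\<phi> j = \<phi> i \<longleftrightarrow> j = i" if "j \<in># m" for j using inj that i by (auto dest: inj_onD)
    have "\<phi> i \<notin># image_mset \<phi> {#j \<in># m. j \<noteq> i#}" by (auto dest: eq)
    then have c: "count (image_mset \<phi> m) (\<phi> i) = count m i"
      by (subst split_mset_at[of m i]) (simp del: in_image_mset set_image_mset add: not_in_iff)
    have f: "{#j \<in># image_mset \<phi> m. j \<noteq> \<phi> i#} = image_mset \<phi> {#j \<in># m. j \<noteq> i#}"
      by (auto simp: filter_mset_image_mset eq intro!: arg_cong[where f = "image_mset \<phi>"] filter_mset_cong)
    have "strict_mono_on (set_mset {#j \<in># m. j \<noteq> i#}) \<phi>"
      using mono by (rule monotone_on_subset) auto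
    then have "Defs.coeff (p (count m i)) (image_mset \<phi> {#j \<in># m. j \<noteq> i#})
        = Defs.coeff (p (count m i)) {#j \<in># m. j \<noteq> i#}"
      by (rule quasisymmetric_rename[OF q])
    then show ?thesis using False by (simp add: coeff_front_mps Mi c f flip: i_def)
  qed (simp add: coeff_front_mps)
qed

definition front :: "'k::comm_ring_1 qsym poly \<Rightarrow> 'k qsym" where
  "front P = Abs_qsym (front_mps (\<lambda>n. mps_of (poly.coeff P n)))"

lemma mcoeff_front:
  "mcoeff (front P) m =
     (if m = {#} then 0 else mcoeff (poly.coeff P (count m (Min (set_mset m)))) (rest m))"
proof -
  have "bounded_degree (front_mps (\<lambda>n. mps_of (poly.coeff P n)))"
    using mps_of by (intro bounded_degree_front[where N = "degree P"])
      (auto simp: coeff_eq_0 zero_qsym.rep_eq)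
  moreover have "quasisymmetric (front_mps (\<lambda>n. mps_of (poly.coeff P n)))"
    using mps_of by (intro quasisymmetric_front) auto
  ultimately show ?thesis by (simp add: front_def Abs_qsym_inverse coeff_front_mps)
qed

lemma qsym_eqI_mcoeff: "(\<And>m. mcoeff f m = mcoeff g m) \<Longrightarrow> f = g"
  by (metis mps_eqI mps_of_inject)

lemma mcoeff_simps [simp]:
  "mcoeff 0 m = 0" "mcoeff (f + g) m = mcoeff f m + mcoeff g m"
  "mcoeff (c *\<^sub>Q f) m = c * mcoeff f m"
  by (simp_all add: zero_qsym.rep_eq zero_mps.rep_eq plus_qsym.rep_eq plus_mps.rep_eq
      qsym_scale.rep_eq mps_scale.rep_eq)

lemma mcoeff_sum: "mcoeff (\<Sum>x\<in>A. F x) m = (\<Sum>x\<in>A. mcoeff (F x) m)"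
  by (induction A rule: infinite_finite_induct) simp_all

lemma mcoeff_mult: "mcoeff (f * g) m = (\<Sum>(a, b) | a + b = m. mcoeff f a * mcoeff g b)"
  by (simp add: times_qsym.rep_eq times_mps.rep_eq)

lemma front_add: "front (P + Q) = front P + front Q"
  by (rule qsym_eqI_mcoeff) (simp add: mcoeff_front)

lemma scale_mult: "(c *\<^sub>Q f) * g = c *\<^sub>Q (f * g)"
  by (rule qsym_eqI_mcoeff)
    (simp add: mcoeff_mult sum_distrib_left case_prod_unfold mult.assoc)

lemma mcoeff_front_add_smallest:
  assumes n: "0 < n" and c: "\<And>j. j \<in># c \<Longrightarrow> i < j"
  shows "mcoeff (front P) (replicate_mset n i + c) = mcoeff (poly.coeff P n) c"
proof -
  let ?m = "replicate_mset n i + c"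
  have Min: "Min (set_mset ?m) = i"
    using n c by (intro Min_eqI) (auto simp: less_imp_le split: if_splits)
  have "i \<notin># c" using c by blast
  then have "count ?m i = n" "{#j \<in># ?m. j \<noteq> i#} = c"
    by (auto simp: not_in_iff filter_mset_eq_conv intro!: multiset_eqI)
  then show ?thesis using n by (simp only: mcoeff_front Min) simp
qed

text \<open>
  A factorisation of \<open>x\<^sub>i\<^sup>n c\<close> amounts to a factorisation of \<open>c\<close> together with a distribution of the \<open>n\<close> copies of
  \<open>x\<^sub>i\<close> over the two factors.
\<close>
lemma sum_union_eq_sum_pairs:
  fixes F :: "nat multiset \<Rightarrow> nat multiset \<Rightarrow> 'k::comm_monoid_add"
  assumes i: "i \<notin># c"
  shows "(\<Sum>(a, b) | a + b = replicate_mset n i + c. F a b) =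
    (\<Sum>k\<le>n. \<Sum>(a, b) | a + b = c. F (replicate_mset k i + a) (replicate_mset (n - k) i + b))"
proof -
  have "(\<Sum>(a, b) | a + b = replicate_mset n i + c. F a b) =
    (\<Sum>(k, a, b) \<in> {..n} \<times> {(a, b). a + b = c}.
      F (replicate_mset k i + a) (replicate_mset (n - k) i + b))"
  proof (rule sum.reindex_bij_witness
      [where i = "\<lambda>(k, a, b). (replicate_mset k i + a, replicate_mset (n - k) i + b)"
         and j = "\<lambda>(a, b). (count a i, {#j \<in># a. j \<noteq> i#}, {#j \<in># b. j \<noteq> i#})"], goal_cases)
    case (1 p)
    then obtain a b where p: "p = (a, b)" "a + b = replicate_mset n i + c" by blast
    have "count a i + count b i = n"
      using arg_cong[OF p(2), of "\<lambda>m. count m i"] i by (simp add: not_in_iff)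
    then have "n - count a i = count b i" by simp
    then show ?case using split_mset_at[of a i] split_mset_at[of b i] by (simp add: p(1))
  next
    case (2 p)
    then obtain a b where p: "p = (a, b)" "a + b = replicate_mset n i + c" by blast
    have "count a i + count b i = n"
      using arg_cong[OF p(2), of "\<lambda>m. count m i"] i by (simp add: not_in_iff)
    moreover have "{#j \<in># a. j \<noteq> i#} + {#j \<in># b. j \<noteq> i#} = c"
    proof (rule multiset_eqI)
      fix j show "count ({#j \<in># a. j \<noteq> i#} + {#j \<in># b. j \<noteq> i#}) j = count c j"
        using arg_cong[OF p(2), of "\<lambda>m. count m j"] i by (auto simp: not_in_iff split: if_splits)
    qed
    ultimately show ?case by (simp add: p(1))
  next
    case (3 p)
    then obtain k a b where p: "p = (k, a, b)" "k \<le> n" "a + b = c" by auto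
    then have "i \<notin># a" "i \<notin># b" using i by auto
    then show ?case by (auto simp: p(1) not_in_iff intro!: multiset_eqI)
  next
    case (4 p)
    then obtain k a b where p: "p = (k, a, b)" "k \<le> n" "a + b = c" by auto
    have "replicate_mset k i + a + (replicate_mset (n - k) i + b)
      = (replicate_mset k i + replicate_mset (n - k) i) + (a + b)" by (simp add: ac_simps)
    also have "\<dots> = replicate_mset n i + c"
      using p by (simp add: multiset_eq_iff)
    finally show ?case by (simp add: p(1))
  next
    case (5 p)
    then obtain a b where p: "p = (a, b)" "a + b = replicate_mset n i + c" by blast
    have "count a i + count b i = n"
      using arg_cong[OF p(2), of "\<lambda>m. count m i"] i by (simp add: not_in_iff)
    then have "n - count a i = count b i" by simp
    then show ?case using split_mset_at[of a i] split_mset_at[of b i] by (simp add: p(1))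
  qed
  then show ?thesis by (simp add: sum.cartesian_product case_prod_unfold)
qed

text \<open>
  In a product of two fronts the smallest variable \<open>x\<^sub>i\<close> of a monomial comes from the first factor only, from the
  second only, or from both; these are the three summands.  A factor that does not contribute \<open>x\<^sub>i\<close> is
  still a front, in the variables beyond \<open>x\<^sub>i\<close>.  A constant coefficient of \<open>P\<close> would contribute to \<open>P * Q\<close> but not to
  \<open>front P\<close>, whence the hypotheses.
\<close>
lemma front_mult:
  assumes P0: "poly.coeff P 0 = 0" and Q0: "poly.coeff Q 0 = 0"
  shows "front P * front Q = front (P * [:front Q:] + [:front P:] * Q + P * Q)"
proof (rule qsym_eqI_mcoeff)
  fix m
  show "mcoeff (front P * front Q) m = mcoeff (front (P * [:front Q:] + [:front P:] * Q + P * Q)) m"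
  proof (cases "m = {#}")
    case True
    then show ?thesis by (simp add: mcoeff_mult mcoeff_front case_prod_unfold)
  next
    case False
    define i n where "i = Min (set_mset m)" and "n = count m i"
    define c where "c = {#j \<in># m. j \<noteq> i#}"
    have i: "i \<in># m" and le: "\<And>j. j \<in># m \<Longrightarrow> i \<le> j" using False by (auto simp: i_def)
    have m: "m = replicate_mset n i + c" unfolding n_def c_def by (rule split_mset_at)
    have n: "0 < n" using i by (simp add: n_def)
    have c: "i < j" if "j \<in># c" for j using that le by (auto simp: c_def le_less)
    then have ic: "i \<notin># c" by blast
    note smallest = mcoeff_front_add_smallest
    \<comment> \<open>\<open>k\<close> is the part of the exponent \<open>n\<close> of the smallest variable that the first factor takes.\<close>
    have part: "(\<Sum>(a, b) | a + b = c. mcoeff (front P) (replicate_mset k i + a)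
            * mcoeff (front Q) (replicate_mset (n - k) i + b))
        = mcoeff (poly.coeff P k * poly.coeff Q (n - k)) c
          + (if k = n then mcoeff (poly.coeff P n * front Q) c else 0)
          + (if k = 0 then mcoeff (front P * poly.coeff Q n) c else 0)" if "k \<le> n" for k
    proof -
      have s: "mcoeff (front P) (replicate_mset k i + a) = mcoeff (poly.coeff P k) a"
        if "a + b = c" "0 < k" for P :: "'a qsym poly" and a b k using that c by (intro smallest) auto
      have s': "mcoeff (front P) (replicate_mset k i + b) = mcoeff (poly.coeff P k) b"
        if "a + b = c" "0 < k" for P :: "'a qsym poly" and a b k using that c by (intro smallest) auto
      consider "k = 0" | "k = n" | "0 < k" "k < n" using \<open>k \<le> n\<close> by linarith
      then show ?thesis
      proof cases
        case 1
        then show ?thesis using n P0 by (auto simp: mcoeff_mult s' intro!: sum.cong)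
      next
        case 2
        then show ?thesis using n Q0 by (auto simp: mcoeff_mult s intro!: sum.cong)
      next
        case 3
        then show ?thesis by (auto simp: mcoeff_mult s s' intro!: sum.cong)
      qed
    qed
    have "mcoeff (front P * front Q) m = (\<Sum>k\<le>n. \<Sum>(a, b) | a + b = c.
      mcoeff (front P) (replicate_mset k i + a) * mcoeff (front Q) (replicate_mset (n - k) i + b))"
      unfolding mcoeff_mult m by (rule sum_union_eq_sum_pairs[OF ic])
    also have "\<dots> = mcoeff (poly.coeff (P * Q) n) c + mcoeff (poly.coeff P n * front Q) c
        + mcoeff (front P * poly.coeff Q n) c"
      by (simp add: part sum.distrib coeff_mult mcoeff_sum)
    also have "\<dots> = mcoeff (front (P * [:front Q:] + [:front P:] * Q + P * Q)) m"
      using n c by (simp add: m smallest mult.commute)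
    finally show ?thesis .
  qed
qed

lemma M_coord_front_Nil: "M_coord (front P) [] = 0"
  by (simp add: M_coord_def mcoeff_front)

text \<open>
  \<open>front\<close> prepends to each composition the exponent of \<open>t\<close>; in particular it sends \<open>M\<^sub>\<alpha> t\<^sup>a\<close> to \<open>M\<^sub>a\<^sub>\<alpha>\<close>.
\<close>
lemma M_coord_front_Cons:
  assumes "a # \<alpha> \<in> Comp"
  shows "M_coord (front P) (a # \<alpha>) = M_coord (poly.coeff P a) \<alpha>"
proof -
  have \<alpha>: "0 < a" "\<alpha> \<in> Comp" using assms by (auto simp: Comp_def)
  let ?is = "[Suc 0..<Suc (length \<alpha>)]"
  have "monomial [0..<length (a # \<alpha>)] (a # \<alpha>) = replicate_mset a 0 + monomial ?is \<alpha>"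
    by (simp add: upt_conv_Cons del: upt_Suc)
  moreover have "0 < j" if "j \<in># monomial ?is \<alpha>" for j
    using set_mp[OF set_monomial_subset that] by auto
  ultimately have "M_coord (front P) (a # \<alpha>) = mcoeff (poly.coeff P a) (monomial ?is \<alpha>)"
    using \<alpha> by (simp only: M_coord_def mcoeff_front_add_smallest)
  also have "\<dots> = M_coord (poly.coeff P a) \<alpha>"
    using \<alpha> by (intro coeff_eq_M_coord) (auto simp del: upt_Suc)
  finally show ?thesis .
qed

lemma front_monom_M:
  assumes "0 < a" "\<alpha> \<in> Comp"
  shows "front (monom (M_basis \<alpha>) a) = M_basis (a # \<alpha>)"
proof (rule qsym_eqI)
  fix \<beta> assume \<beta>: "\<beta> \<in> Comp"
  have a: "a # \<alpha> \<in> Comp" using assms by (auto simp: Comp_def)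
  show "M_coord (front (monom (M_basis \<alpha>) a)) \<beta> = M_coord (M_basis (a # \<alpha>)) \<beta>"
  proof (cases \<beta>)
    case Nil
    then show ?thesis using a \<beta> by (simp add: M_coord_front_Nil M_coord_M)
  next
    case (Cons b \<gamma>)
    moreover have "\<gamma> \<in> Comp" using Cons \<beta> by (auto simp: Comp_def)
    ultimately show ?thesis using a \<beta> assms by (simp add: M_coord_front_Cons M_coord_M M_coord_0)
  qed
qed

section \<open>Gluing and merging letters\<close>

definition scalar :: "'k::comm_ring_1 \<Rightarrow> 'k qsym" where
  "scalar c = c *\<^sub>Q 1"

lemma scalar_mult: "scalar c * f = c *\<^sub>Q f"
  by (simp add: scalar_def scale_mult)

lemma scalar_hom [simp]: "scalar 0 = 0" "scalar 1 = 1" "scalar (c + d) = scalar c + scalar d"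
  "scalar (c * d) = scalar c * scalar d" "scalar (- c) = - scalar c" "scalar (c - d) = scalar c - scalar d"
  by (simp_all add: scalar_def qsym.scale_left_distrib qsym.scale_left_diff_distrib scale_mult)

text \<open>
  QSym[t] as a module over the base ring.  The operator \<open>front\<close> is linear over these scalars only, not over QSym.
\<close>
definition poly_scale :: "'k::comm_ring_1 \<Rightarrow> 'k qsym poly \<Rightarrow> 'k qsym poly" where
  "poly_scale c P = [:scalar c:] * P"

global_interpretation pmod: module "poly_scale :: 'k::comm_ring_1 \<Rightarrow> 'k qsym poly \<Rightarrow> 'k qsym poly"
  defines poly_span = pmod.span
  by standard (simp_all add: poly_scale_def smult_add_right smult_add_left mult.commute)

lemma coeff_poly_scale [simp]: "poly.coeff (poly_scale c P) n = c *\<^sub>Q poly.coeff P n"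
  by (simp add: poly_scale_def scalar_mult)

lemma poly_scale_mult: "poly_scale c P * Q = poly_scale c (P * Q)" "P * poly_scale c Q = poly_scale c (P * Q)"
  by (simp_all add: poly_scale_def)

lemma front_scale: "front (poly_scale c P) = c *\<^sub>Q front P"
  by (rule qsym_eqI_mcoeff) (simp add: mcoeff_front)

lemma front_minus: "front (- P) = - front P"
  using front_scale[of "-1" P] by simp

lemma front_smult_scalar: "front (smult (scalar c) P) = scalar c * front P"
  using front_scale[of c P] by (simp add: poly_scale_def scalar_mult)

text \<open>
  Completes the part of positive degree to a polynomial whose constant coefficient is determined by it.
\<close>
definition with_front :: "'k::comm_ring_1 \<Rightarrow> 'k qsym poly \<Rightarrow> 'k qsym poly" where
  "with_front r Z = Z + [:r *\<^sub>Q front Z:]"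

text \<open>
  The recursion \<open>P\<^sub>w \<mapsto> P\<^sub>x\<^sub>w\<close>.  The proper suffixes of \<open>xw\<close> are the suffixes of \<open>w\<close>, and each now leaves \<open>x\<close> more in
  front of it; this is the multiplication by \<open>t\<^sup>x\<close>.  The constant coefficient reflects that the
  first block of a coarsening of \<open>xw\<close> is \<open>x\<close> plus a sum of initial letters of \<open>w\<close> and carries one factor \<open>r\<close>.
\<close>
definition glue :: "'k::comm_ring_1 \<Rightarrow> nat \<Rightarrow> 'k qsym poly \<Rightarrow> 'k qsym poly" where
  "glue r x P = with_front r (monom 1 x * P)"

definition strip :: "'k::comm_ring_1 qsym poly \<Rightarrow> 'k qsym poly" where
  "strip P = P - [:poly.coeff P 0:]"

text \<open>
  Inserting a further variable \<open>t\<close> in front of all others turns \<open>\<eta>\<^sub>w\<close> into \<open>f + r F\<close>, where \<open>f\<close> is the constant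
  coefficient of \<open>P\<^sub>w\<close> and \<open>F\<close> the rest.  The map \<open>f + F \<mapsto> f + r F\<close> takes the following product to the ordinary
  product of QSym[t]; the definition avoids the inverse of that map, which need not exist.
\<close>
definition twisted_mult :: "'k::comm_ring_1 \<Rightarrow> 'k qsym poly \<Rightarrow> 'k qsym poly \<Rightarrow> 'k qsym poly" where
  "twisted_mult r P Q = P * Q + poly_scale (r - 1) (strip P * strip Q)"

lemma with_front_hom: "module_hom poly_scale poly_scale (with_front r)"
  by unfold_locales
    (simp_all add: with_front_def front_add front_scale poly_scale_def front_smult_scalar
      smult_add_right distrib_left mult.left_commute flip: scalar_mult)

lemma glue_hom: "module_hom poly_scale poly_scale (glue r x)"
  using module_hom.add[OF with_front_hom] module_hom.scale[OF with_front_hom]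
  by unfold_locales (auto simp: glue_def distrib_left poly_scale_mult)

lemma strip_hom: "module_hom poly_scale poly_scale strip"
  by unfold_locales (auto simp: strip_def poly_scale_def algebra_simps scalar_mult)

lemma merge_hom: "module_hom poly_scale poly_scale (\<lambda>P. glue r x (strip P))"
  using module_hom_compose[OF strip_hom glue_hom] by (simp add: comp_def)

lemma coeff_glue: "0 < x \<Longrightarrow> poly.coeff (glue r x P) 0 = r *\<^sub>Q front (monom 1 x * P)"
  by (simp add: glue_def with_front_def coeff_mult_0)

lemma strip_glue: "0 < x \<Longrightarrow> strip (glue r x P) = monom 1 x * P"
  by (simp add: strip_def coeff_glue) (simp add: glue_def with_front_def)

text \<open>
  In terms of words, \<open>x\<close> is merged into the first letter \<open>y\<close>: a glued polynomial without its constant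
  coefficient is a multiple of \<open>t\<^sup>y\<close>, and the powers of \<open>t\<close> multiply.
\<close>
lemma merge_glue: "0 < y \<Longrightarrow> glue r x (strip (glue r y P)) = glue r (x + y) P"
  by (simp add: strip_glue) (simp add: glue_def mult_monom flip: mult.assoc)

text \<open>
  The comparison of the parts of positive degree in the recursion below: there \<open>X = t\<^sup>x\<close>, \<open>Y = t\<^sup>y\<close>, and \<open>f\<close>, \<open>g\<close> are
  the constant coefficients of the two glued polynomials.
\<close>
lemma twisted_mult_glue_identity:
  fixes X Y f g F F' G G' \<rho> :: "'a::comm_ring_1"
  assumes "P = F + G" and "Q = F' + G'"
  shows "f * (Y * Q) + g * (X * P) + \<rho> * (X * P * (Y * Q)) =
    X * (P * (Y * Q + g) + (\<rho> - 1) * (G * (Y * Q)))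
    + Y * ((X * P + f) * Q + (\<rho> - 1) * (X * P * G'))
    + (\<rho> - 2) * (X * Y * (P * Q + (\<rho> - 1) * (G * G')))
    - (\<rho> - 1) * (X * Y * (F * G' + F' * G + \<rho> * (G * G')))"
  unfolding assms by (simp add: algebra_simps)

text \<open>
  The quasi-shuffle recursion for the \<open>\<eta>\<close>-functions: the first letter of a term is \<open>x\<close>, or \<open>y\<close>, or \<open>x + y\<close>, or
  \<open>x + y\<close> merged with the next letter.  Both sides have the form \<open>with_front r Z\<close>: for the right-hand side by
  definition of \<open>glue\<close>, for the left-hand side by the Rota--Baxter identity.  Hence it suffices to compare the parts
  of positive degree, which is a polynomial identity.
\<close>
lemma twisted_mult_glue:
  assumes x: "0 < x" and y: "0 < y"
  shows "twisted_mult r (glue r x P) (glue r y Q) =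
    glue r x (twisted_mult r P (glue r y Q)) + glue r y (twisted_mult r (glue r x P) Q)
    + poly_scale (r - 2) (glue r (x + y) (twisted_mult r P Q))
    - poly_scale (r - 1) (glue r (x + y) (strip (twisted_mult r P Q)))"
proof -
  interpret wf: module_hom poly_scale poly_scale "with_front r" by (rule with_front_hom)
  let ?\<rho> = "[:scalar r:]"
  define X Y where "X = monom (1 :: 'a qsym) x" and "Y = monom (1 :: 'a qsym) y"
  define A B where "A = X * P" and "B = Y * Q"
  define f g where "f = scalar r * front A" and "g = scalar r * front B"
  define Z where "Z = [:f:] * B + [:g:] * A + ?\<rho> * (A * B)"
  have XY: "monom 1 (x + y) = X * Y" by (simp add: X_def Y_def mult_monom)
  have A: "glue r x P = A + [:f:]" and B: "glue r y Q = B + [:g:]"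
    by (simp_all add: glue_def with_front_def A_def B_def X_def Y_def f_def g_def scalar_mult)
  have A0: "poly.coeff A 0 = 0" "poly.coeff B 0 = 0"
    using x y by (simp_all add: A_def B_def X_def Y_def coeff_mult_0)
  have sA: "strip (A + [:f:]) = A" "strip (B + [:g:]) = B"
    by (simp_all add: strip_def A0)
  define F G F' G' where "F = [:poly.coeff P 0:]" and "G = strip P"
    and "F' = [:poly.coeff Q 0:]" and "G' = strip Q"
  have PQ: "P = F + G" "Q = F' + G'" by (simp_all add: F_def G_def F'_def G'_def strip_def)
  have G0: "poly.coeff G 0 = 0" "poly.coeff G' 0 = 0" by (simp_all add: G_def G'_def strip_def)
  have twisted_mult: "twisted_mult r P Q = P * Q + (?\<rho> - 1) * (G * G')"
    by (simp add: twisted_mult_def poly_scale_def G_def G'_def one_pCons)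
  have "[:poly.coeff (twisted_mult r P Q) 0:] = F * F'"
    by (simp add: twisted_mult coeff_mult_0 G0) (simp add: F_def F'_def)
  then have sPQ: "strip (twisted_mult r P Q) = F * G' + F' * G + ?\<rho> * (G * G')"
    unfolding strip_def twisted_mult by (simp add: PQ distrib_left distrib_right left_diff_distrib)
  \<comment> \<open>The constant coefficient of the product, by the Rota--Baxter identity.\<close>
  have fg: "f * g = scalar r * front Z"
  proof -
    have "f * g = scalar r * (scalar r * (front A * front B))" by (simp add: f_def g_def ac_simps)
    also have "scalar r * (front A * front B) = front (?\<rho> * (A * [:front B:] + [:front A:] * B + A * B))"
      by (simp add: front_mult[OF A0] front_smult_scalar)
    also have "?\<rho> * (A * [:front B:] + [:front A:] * B + A * B) = Z"
      by (simp add: Z_def f_def g_def smult_add_right algebra_simps)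
    finally show ?thesis .
  qed
  have "twisted_mult r (glue r x P) (glue r y Q) = with_front r Z"
  proof -
    have "twisted_mult r (glue r x P) (glue r y Q) = Z + [:f * g:]"
      unfolding A B twisted_mult_def sA poly_scale_def Z_def
      by (simp add: algebra_simps one_pCons smult_diff_left)
    then show ?thesis by (simp only: fg with_front_def scalar_mult)
  qed
  also have "Z = X * twisted_mult r P (glue r y Q) + Y * twisted_mult r (glue r x P) Q
      + poly_scale (r - 2) (X * Y * twisted_mult r P Q) - poly_scale (r - 1) (X * Y * strip (twisted_mult r P Q))"
  proof -
    have r: "[:scalar (r - 1):] = ?\<rho> - 1" "[:scalar (r - 2):] = ?\<rho> - 2"
      using scalar_hom(3)[of 1 1] by (simp_all add: one_pCons numeral_poly)
    then have "twisted_mult r P (B + [:g:]) = P * (B + [:g:]) + (?\<rho> - 1) * (G * B)"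
      "twisted_mult r (A + [:f:]) Q = (A + [:f:]) * Q + (?\<rho> - 1) * (A * G')"
      by (simp_all only: twisted_mult_def sA poly_scale_def G_def G'_def)
    then show ?thesis
      by (simp only: A B sPQ) (simp only: twisted_mult r Z_def A_def B_def poly_scale_def twisted_mult_glue_identity[OF PQ])
  qed
  also have "with_front r \<dots> = glue r x (twisted_mult r P (glue r y Q)) + glue r y (twisted_mult r (glue r x P) Q)
    + poly_scale (r - 2) (glue r (x + y) (twisted_mult r P Q))
    - poly_scale (r - 1) (glue r (x + y) (strip (twisted_mult r P Q)))"
    by (simp add: wf.add wf.diff wf.scale glue_def XY X_def[symmetric] Y_def[symmetric])
  finally show ?thesis .
qed

section \<open>The span of the words over an additively closed alphabet\<close>

definition eta_poly :: "'k::comm_ring_1 \<Rightarrow> nat list \<Rightarrow> 'k qsym poly" where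
  "eta_poly r w = foldr (glue r) w 1"

lemma eta_poly_simps [simp]: "eta_poly r [] = 1" "eta_poly r (x # w) = glue r x (eta_poly r w)"
  by (simp_all add: eta_poly_def)

lemma strip_1 [simp]: "strip 1 = 0"
  by (simp add: strip_def one_pCons)

definition word_span :: "'k::comm_ring_1 \<Rightarrow> nat set \<Rightarrow> 'k qsym poly set" where
  "word_span r Y = poly_span (eta_poly r ` lists Y)"

lemma glue_word_span:
  assumes "P \<in> word_span r Y" and x: "x \<in> Y"
  shows "glue r x P \<in> word_span r Y"
  using assms(1) unfolding word_span_def
proof (induction rule: pmod.span_induct_alt)
  case base
  then show ?case using module_hom.zero[OF glue_hom] pmod.span_zero by metis
next
  case (step c Q P)
  then obtain w where w: "Q = eta_poly r w" "w \<in> lists Y" by blast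
  then have "glue r x Q \<in> poly_span (eta_poly r ` lists Y)"
    using x by (intro pmod.span_base) (auto simp flip: eta_poly_simps)
  then show ?case using step
    by (simp add: module_hom.add[OF glue_hom] module_hom.scale[OF glue_hom] pmod.span_add pmod.span_scale)
qed

text \<open>
  The letter \<open>x + y\<close> that replaces \<open>y\<close> belongs to \<open>Y\<close> again.
\<close>
lemma merge_word_span:
  assumes "P \<in> word_span r Y" and x: "x \<in> Y"
    and pos: "Y \<subseteq> {1..}" and Y: "\<And>y z. y \<in> Y \<Longrightarrow> z \<in> Y \<Longrightarrow> y + z \<in> Y"
  shows "glue r x (strip P) \<in> word_span r Y"
  using assms(1) unfolding word_span_def
proof (induction rule: pmod.span_induct_alt)
  case base
  then show ?case using module_hom.zero[OF merge_hom] pmod.span_zero by metis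
next
  case (step c Q P)
  then obtain w where w: "Q = eta_poly r w" "w \<in> lists Y" by blast
  have "glue r x (strip Q) \<in> poly_span (eta_poly r ` lists Y)"
  proof (cases w)
    case Nil
    then show ?thesis using w by (simp add: module_hom.zero[OF glue_hom] pmod.span_zero)
  next
    case (Cons y v)
    then have "glue r x (strip Q) = eta_poly r ((x + y) # v)"
      using w pos by (auto simp: merge_glue)
    then show ?thesis using w Cons x Y by (auto intro!: pmod.span_base imageI simp del: eta_poly_simps)
  qed
  then show ?case using step
    by (simp add: module_hom.add[OF merge_hom] module_hom.scale[OF merge_hom] pmod.span_add pmod.span_scale)
qed

text \<open>
  By induction on the total length: the empty word is the unit, and in the recursion for two nonempty words only letters
  \<open>x\<close>, \<open>y\<close> and \<open>x + y\<close> are glued or merged.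
\<close>
lemma twisted_mult_eta_poly_word_span:
  assumes pos: "Y \<subseteq> {1..}" and Y: "\<And>y z. y \<in> Y \<Longrightarrow> z \<in> Y \<Longrightarrow> y + z \<in> Y"
    and "v \<in> lists Y" "w \<in> lists Y"
  shows "twisted_mult r (eta_poly r v) (eta_poly r w) \<in> word_span r Y"
  using assms(3,4)
proof (induction "length v + length w" arbitrary: v w rule: less_induct)
  case less
  have base: "eta_poly r u \<in> word_span r Y" if "u \<in> lists Y" for u
    using that unfolding word_span_def by (intro pmod.span_base) auto
  show ?case
  proof (cases "v = [] \<or> w = []")
    case True
    then show ?thesis using base[OF less.prems(1)] base[OF less.prems(2)] by (auto simp: twisted_mult_def)
  next
    case False
    then obtain x a y b where vw: "v = x # a" "w = y # b" by (metis neq_Nil_conv)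
    have xy: "x \<in> Y" "y \<in> Y" "x + y \<in> Y" "0 < x" "0 < y" using less.prems vw pos Y by auto
    have "twisted_mult r (eta_poly r a) (eta_poly r (y # b)) \<in> word_span r Y"
      "twisted_mult r (eta_poly r (x # a)) (eta_poly r b) \<in> word_span r Y"
      "twisted_mult r (eta_poly r a) (eta_poly r b) \<in> word_span r Y"
      using less.prems vw less.hyps[of a "y # b"] less.hyps[of "x # a" b] less.hyps[of a b] by auto
    then have "glue r x (twisted_mult r (eta_poly r a) (glue r y (eta_poly r b))) \<in> word_span r Y"
      "glue r y (twisted_mult r (glue r x (eta_poly r a)) (eta_poly r b)) \<in> word_span r Y"
      "glue r (x + y) (twisted_mult r (eta_poly r a) (eta_poly r b)) \<in> word_span r Y"
      "glue r (x + y) (strip (twisted_mult r (eta_poly r a) (eta_poly r b))) \<in> word_span r Y"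
      using xy glue_word_span merge_word_span[OF _ _ pos Y] by (auto simp: vw)
    then show ?thesis unfolding vw eta_poly_simps twisted_mult_glue[OF xy(4,5)] unfolding word_span_def
      by (intro pmod.span_add pmod.span_diff pmod.span_scale)
  qed
qed

section \<open>Coarsenings\<close>

fun merge :: "nat \<Rightarrow> nat list \<Rightarrow> nat list" where
  "merge x [] = [x]"
| "merge x (b # \<beta>) = (x + b) # \<beta>"

text \<open>
  A recursive description of the compositions \<open>\<beta>\<close> with \<open>D(\<beta>) \<subseteq> D(w)\<close>: either there is a cut after the first letter of
  \<open>w\<close>, or the first letter is absorbed by the first block of a coarsening of the remaining word.
\<close>
fun coarsenings :: "nat list \<Rightarrow> nat list set" where
  "coarsenings [] = {[]}"
| "coarsenings (x # w) = Cons x ` coarsenings w \<union> merge x ` (coarsenings w - {[]})"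

lemma finite_coarsenings [simp]: "finite (coarsenings w)"
  by (induction w) auto

lemma coarsenings_Comp: "\<beta> \<in> coarsenings w \<Longrightarrow> w \<in> Comp \<Longrightarrow> \<beta> \<in> Comp"
proof (induction w arbitrary: \<beta>)
  case (Cons x w)
  then obtain \<gamma> where \<gamma>: "\<gamma> \<in> coarsenings w" "\<beta> = x # \<gamma> \<or> \<beta> = merge x \<gamma>" by auto
  then have "\<gamma> \<in> Comp" using Cons by (auto simp: Comp_def)
  then show ?case using \<gamma>(2) Cons.prems(2) by (cases \<gamma>) (auto simp: Comp_def)
qed auto

lemma coarsenings_sum_list: "\<beta> \<in> coarsenings w \<Longrightarrow> sum_list \<beta> = sum_list w"
proof (induction w arbitrary: \<beta>)
  case (Cons x w)
  then obtain \<gamma> where \<gamma>: "\<gamma> \<in> coarsenings w" "\<beta> = x # \<gamma> \<or> \<beta> = merge x \<gamma>" by auto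
  then show ?case using Cons.IH[OF \<gamma>(1)] by (cases \<gamma>) auto
qed auto

text \<open>
  The two kinds of coarsenings are disjoint since a block that absorbs \<open>x\<close> is larger than \<open>x\<close>.
\<close>
lemma sum_coarsenings_Cons:
  assumes w: "w \<in> Comp"
  shows "(\<Sum>\<beta> \<in> coarsenings (x # w). F \<beta>) =
    (\<Sum>\<beta> \<in> coarsenings w. F (x # \<beta>) + (if \<beta> = [] then 0 else F (merge x \<beta>)))"
proof -
  let ?C = "coarsenings w"
  have pos: "0 < b" if "b # \<beta> \<in> ?C" for b \<beta>
    using coarsenings_Comp[OF that w] by (auto simp: Comp_def)
  have disj: "Cons x ` ?C \<inter> merge x ` (?C - {[]}) = {}"
  proof -
    have "x # \<beta> \<noteq> merge x \<gamma>" if "\<gamma> \<in> ?C" "\<gamma> \<noteq> []" for \<beta> \<gamma>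
      using that pos by (cases \<gamma>) auto
    then show ?thesis by blast
  qed
  have inj: "inj_on (merge x) (?C - {[]})"
  proof (rule inj_onI)
    fix \<beta> \<gamma> assume "\<beta> \<in> ?C - {[]}" "\<gamma> \<in> ?C - {[]}" "merge x \<beta> = merge x \<gamma>"
    then show "\<beta> = \<gamma>" by (cases \<beta>; cases \<gamma>) auto
  qed
  have "(\<Sum>\<beta> \<in> coarsenings (x # w). F \<beta>) = (\<Sum>\<beta> \<in> ?C. F (x # \<beta>)) + (\<Sum>\<beta> \<in> ?C - {[]}. F (merge x \<beta>))"
    by (simp add: sum.union_disjoint[OF _ _ disj] sum.reindex[OF inj] sum.reindex)
  also have "(\<Sum>\<beta> \<in> ?C - {[]}. F (merge x \<beta>)) = (\<Sum>\<beta> \<in> ?C. if \<beta> = [] then 0 else F (merge x \<beta>))"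
    by (rule sum.mono_neutral_cong_left) auto
  finally show ?thesis by (simp only: sum.distrib)
qed

lemma Dset_Nil [simp]: "Dset [] = {}" by (auto simp: Dset_def)

lemma Dset_Cons: "Dset (x # w) = (if w = [] then {} else insert x ((+) x ` Dset w))"
proof (cases "w = []")
  case False
  have "{1..<length (x # w)} = insert 1 (Suc ` {1..<length w})"
    using False by (auto simp: image_Suc_atLeastLessThan)
  then have "Dset (x # w) = (\<lambda>i. sum_list (take i (x # w))) ` insert 1 (Suc ` {1..<length w})"
    unfolding Dset_def by blast
  also have "\<dots> = insert x ((+) x ` (\<lambda>i. sum_list (take i w)) ` {1..<length w})"
    unfolding image_insert image_image by simp
  also have "(\<lambda>i. sum_list (take i w)) ` {1..<length w} = Dset w"
    by (auto simp: Dset_def)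
  finally show ?thesis using False by simp
qed (simp add: Dset_def)

lemma Dset_pos: "w \<in> Comp \<Longrightarrow> s \<in> Dset w \<Longrightarrow> 0 < s"
  by (cases w) (auto simp: Dset_Cons Comp_def split: if_splits)

lemma Comp_Cons [simp]: "x # w \<in> Comp \<longleftrightarrow> 0 < x \<and> w \<in> Comp" "[] \<in> Comp"
  by (auto simp: Comp_def)

text \<open>
  The proper partial sums of \<open>xw\<close> are \<open>x\<close> and the shifts by \<open>x\<close> of those of \<open>w\<close>.  So \<open>D(\<beta>) \<subseteq> D(xw)\<close> forces the first
  block of \<open>\<beta>\<close> to be at least \<open>x\<close>, and the cases of equality and strict inequality are the two cases of the recursion.
\<close>
lemma coarsenings_eq:
  assumes "w \<in> Comp"
  shows "{\<beta> \<in> Comp_of (sum_list w). Dset \<beta> \<subseteq> Dset w} = coarsenings w"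
  using assms
proof (induction w)
  case Nil
  have "\<beta> = []" if "\<beta> \<in> Comp" "sum_list \<beta> = 0" for \<beta> using that by (cases \<beta>) auto
  then show ?case by (auto simp: Comp_of_def)
next
  case (Cons x w)
  then have x: "0 < x" and w: "w \<in> Comp" by auto
  have IH: "\<beta> \<in> coarsenings w \<longleftrightarrow> \<beta> \<in> Comp \<and> sum_list \<beta> = sum_list w \<and> Dset \<beta> \<subseteq> Dset w" for \<beta>
    using Cons by (auto simp: Comp_of_def)
  have shift: "A \<subseteq> Dset w" if "(+) x ` A \<subseteq> Dset (x # w)" "\<And>s. s \<in> A \<Longrightarrow> 0 < s" for A
    using that by (fastforce simp: Dset_Cons split: if_splits)
  have nil: "\<beta> = [] \<longleftrightarrow> w = []" if "\<beta> \<in> coarsenings w" for \<beta>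
  proof -
    have "\<beta> \<in> Comp" "sum_list \<beta> = sum_list w" using that by (simp_all add: IH)
    then show ?thesis using w by (cases \<beta>; cases w) auto
  qed
  show ?case
  proof (intro set_eqI iffI)
    fix \<beta> assume "\<beta> \<in> {\<beta> \<in> Comp_of (sum_list (x # w)). Dset \<beta> \<subseteq> Dset (x # w)}"
    then have \<beta>: "\<beta> \<in> Comp" "sum_list \<beta> = x + sum_list w" and D: "Dset \<beta> \<subseteq> Dset (x # w)"
      by (auto simp: Comp_of_def)
    with x obtain b \<gamma> where b: "\<beta> = b # \<gamma>" by (cases \<beta>) auto
    have ge: "x \<le> s" if "s \<in> Dset (x # w)" for s
      using that by (auto simp: Dset_Cons split: if_splits)
    have "x \<le> b"
    proof (cases "\<gamma> = []")
      case True then show ?thesis using \<beta> b by simp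
    next
      case False then show ?thesis using D ge by (auto simp: b Dset_Cons)
    qed
    show "\<beta> \<in> coarsenings (x # w)"
    proof (cases "b = x")
      case True
      have "(+) x ` Dset \<gamma> \<subseteq> Dset (x # w)"
        using D by (cases "\<gamma> = []") (auto simp: b True Dset_Cons[of x \<gamma>])
      then have "Dset \<gamma> \<subseteq> Dset w" using \<beta> b by (intro shift) (auto intro: Dset_pos[of \<gamma>])
      then have "\<gamma> \<in> coarsenings w" using \<beta> b True by (simp add: IH)
      then show ?thesis by (simp add: b True)
    next
      case False
      define c where "c = b - x"
      have c: "b = x + c" "0 < c" using False \<open>x \<le> b\<close> by (auto simp: c_def)
      have "(+) x ` Dset (c # \<gamma>) = Dset \<beta>" by (auto simp: b c Dset_Cons image_image add.assoc)
      then have "Dset (c # \<gamma>) \<subseteq> Dset w"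
        using D \<beta> b c by (intro shift) (auto intro: Dset_pos[of "c # \<gamma>"])
      then have "c # \<gamma> \<in> coarsenings w" using \<beta> b c by (auto simp: IH)
      then have "merge x (c # \<gamma>) \<in> coarsenings (x # w)" by (auto simp del: merge.simps)
      then show ?thesis by (simp add: b c)
    qed
  next
    fix \<beta> assume \<beta>: "\<beta> \<in> coarsenings (x # w)"
    then obtain \<gamma> where \<gamma>: "\<gamma> \<in> coarsenings w" "\<beta> = x # \<gamma> \<or> \<gamma> \<noteq> [] \<and> \<beta> = merge x \<gamma>" by auto
    have "Dset \<beta> \<subseteq> Dset (x # w)"
      using \<gamma>(2)
    proof
      assume "\<beta> = x # \<gamma>"
      then show ?thesis using \<gamma>(1) nil[OF \<gamma>(1)] by (auto simp: Dset_Cons IH)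
    next
      assume "\<gamma> \<noteq> [] \<and> \<beta> = merge x \<gamma>"
      then obtain c \<delta> where c: "\<gamma> = c # \<delta>" "\<beta> = (x + c) # \<delta>" by (cases \<gamma>) auto
      have "Dset \<beta> = (+) x ` Dset \<gamma>" by (auto simp: c Dset_Cons image_image add.assoc)
      then show ?thesis using \<gamma>(1) nil[OF \<gamma>(1)] by (auto simp: Dset_Cons[of x w] IH c)
    qed
    then show "\<beta> \<in> {\<beta> \<in> Comp_of (sum_list (x # w)). Dset \<beta> \<subseteq> Dset (x # w)}"
      using \<beta> Cons.prems coarsenings_Comp[OF \<beta>] coarsenings_sum_list[OF \<beta>]
      by (auto simp: Comp_of_def simp del: coarsenings.simps)
  qed
qed

lemma Nil_in_coarsenings_iff [simp]: "[] \<in> coarsenings w \<longleftrightarrow> w = []"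
proof (cases w)
  case (Cons x v)
  have "[] \<noteq> merge x \<beta>" for \<beta> by (cases \<beta>) auto
  then show ?thesis by (auto simp: Cons)
qed simp

lemma coarsenings_ConsE:
  assumes "\<beta> \<in> coarsenings (x # w)"
  obtains \<gamma> where "\<gamma> \<in> coarsenings w" "\<beta> = x # \<gamma>"
    | c \<gamma> where "c # \<gamma> \<in> coarsenings w" "\<beta> = (x + c) # \<gamma>"
proof -
  have "\<exists>c \<gamma>. c # \<gamma> \<in> coarsenings w \<and> merge x \<delta> = (x + c) # \<gamma>" if "\<delta> \<in> coarsenings w" "\<delta> \<noteq> []" for \<delta>
    using that by (cases \<delta>) auto
  then show ?thesis using assms that by auto
qed

lemma coarsenings_ConsI:
  "\<gamma> \<in> coarsenings w \<Longrightarrow> x # \<gamma> \<in> coarsenings (x # w)"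
  "c # \<gamma> \<in> coarsenings w \<Longrightarrow> (x + c) # \<gamma> \<in> coarsenings (x # w)"
  using merge.simps(2)[of x c \<gamma>] by (auto simp del: merge.simps simp flip: merge.simps(2))

lemma coarsenings_append:
  "\<beta> \<in> coarsenings v \<Longrightarrow> \<gamma> \<in> coarsenings w \<Longrightarrow> \<beta> @ \<gamma> \<in> coarsenings (v @ w)"
proof (induction v arbitrary: \<beta>)
  case (Cons x v)
  from Cons.prems(1) show ?case
  proof (cases rule: coarsenings_ConsE)
    case (1 \<beta>')
    then show ?thesis using Cons.IH[OF 1(1) Cons.prems(2)] coarsenings_ConsI(1) by simp
  next
    case (2 c \<beta>')
    then show ?thesis using Cons.IH[OF 2(1) Cons.prems(2)] coarsenings_ConsI(2) by simp
  qed
qed simp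

lemma coarsenings_appendE:
  assumes "\<beta> @ \<gamma> \<in> coarsenings u"
  obtains v w where "u = v @ w" "\<beta> \<in> coarsenings v" "\<gamma> \<in> coarsenings w"
  using assms
proof (induction u arbitrary: \<beta> thesis)
  case Nil
  then show ?case by (metis append_is_Nil_conv coarsenings.simps(1) singletonD singletonI)
next
  case (Cons x u)
  show ?case
  proof (cases \<beta>)
    case Nil
    then show ?thesis using Cons.prems by (metis append_Nil coarsenings.simps(1) singletonI)
  next
    case (Cons b \<beta>')
    from Cons.prems(2) show ?thesis
    proof (cases rule: coarsenings_ConsE)
      case (1 \<delta>)
      then have "\<beta>' @ \<gamma> \<in> coarsenings u" "b = x" using Cons by auto
      then show ?thesis using Cons.IH[of \<beta>'] Cons.prems(1) coarsenings_ConsI(1) Cons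
        by (metis append_Cons)
    next
      case (2 c \<delta>)
      then have "(c # \<beta>') @ \<gamma> \<in> coarsenings u" "b = x + c" using Cons by auto
      then show ?thesis using Cons.IH[of "c # \<beta>'"] Cons.prems(1) coarsenings_ConsI(2) Cons
        by (metis append_Cons)
    qed
  qed
qed

lemma append_in_coarsenings_iff:
  "\<beta> @ \<gamma> \<in> coarsenings u \<longleftrightarrow> (\<exists>v w. v @ w = u \<and> \<beta> \<in> coarsenings v \<and> \<gamma> \<in> coarsenings w)"
  by (metis coarsenings_append coarsenings_appendE)

text \<open>
  The recursion works at the front of a word; for the reversal one needs merging at its end.
\<close>
lemma coarsenings_snoc_merge:
  "\<beta> @ [b] \<in> coarsenings w \<Longrightarrow> \<beta> @ [b + x] \<in> coarsenings (w @ [x])"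
proof (induction w arbitrary: \<beta> b)
  case (Cons y w)
  from Cons.prems show ?case
  proof (cases rule: coarsenings_ConsE)
    case (1 \<gamma>)
    show ?thesis
    proof (cases \<beta>)
      case Nil
      then have "w = []" "b = y" using 1 by auto
      then show ?thesis using coarsenings_ConsI(2)[of x "[]" "[x]" y] by (simp add: Nil)
    next
      case (Cons _ \<beta>')
      then show ?thesis using 1 Cons.IH coarsenings_ConsI(1) by auto
    qed
  next
    case (2 c \<gamma>)
    show ?thesis
    proof (cases \<beta>)
      case Nil
      then have "[c + x] \<in> coarsenings (w @ [x])" "b = y + c" using 2 Cons.IH[of "[]" c] by auto
      then show ?thesis using coarsenings_ConsI(2)[of "c + x" "[]" "w @ [x]" y] by (simp add: Nil add.assoc)
    next
      case (Cons _ \<beta>')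
      then have "c # \<beta>' @ [b + x] \<in> coarsenings (w @ [x])" "\<beta> = (y + c) # \<beta>'"
        using 2 Cons.IH[of "c # \<beta>'" b] by auto
      then show ?thesis using coarsenings_ConsI(2) by (simp del: coarsenings.simps)
    qed
  qed
qed simp

lemma rev_in_coarsenings: "\<beta> \<in> coarsenings w \<Longrightarrow> rev \<beta> \<in> coarsenings (rev w)"
proof (induction w arbitrary: \<beta>)
  case (Cons x w)
  from Cons.prems show ?case
  proof (cases rule: coarsenings_ConsE)
    case (1 \<gamma>)
    then show ?thesis using coarsenings_append[OF Cons.IH[OF 1(1)], of "[x]" "[x]"] by simp
  next
    case (2 c \<gamma>)
    then show ?thesis using coarsenings_snoc_merge[of "rev \<gamma>" c "rev w" x] Cons.IH[OF 2(1)]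
      by (simp add: add.commute)
  qed
qed simp

lemma coarsenings_rev: "coarsenings (rev w) = rev ` coarsenings w"
proof
  show "coarsenings (rev w) \<subseteq> rev ` coarsenings w"
  proof
    fix \<beta> assume "\<beta> \<in> coarsenings (rev w)"
    then have "rev \<beta> \<in> coarsenings w" using rev_in_coarsenings by fastforce
    then show "\<beta> \<in> rev ` coarsenings w" by (metis image_eqI rev_rev_ident)
  qed
qed (auto intro: rev_in_coarsenings)

lemma rev_Comp [simp]: "rev \<alpha> \<in> Comp \<longleftrightarrow> \<alpha> \<in> Comp"
  by (simp add: Comp_def)

section \<open>The enriched monomial functions as constant coefficients\<close>

lemma M_basis_Nil: "M_basis [] = 1"
  by (rule qsym_eqI_mcoeff)
    (simp add: M_basis.rep_eq Abs_mps_inverse one_qsym.rep_eq one_mps.rep_eq)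

lemma eta_eq_sum_coarsenings:
  "\<alpha> \<in> Comp \<Longrightarrow> eta q \<alpha> = (\<Sum>\<beta> \<in> coarsenings \<alpha>. (q + 1) ^ length \<beta> *\<^sub>Q M_basis \<beta>)"
  by (simp add: eta_def coarsenings_eq)

text \<open>
  The contribution of a single coarsening to \<open>P\<^sub>w\<close>: \<open>r\<^bsup>\<ell>(\<beta>)\<^esup> M\<^sub>\<beta>\<close> in degree 0, and the same expression for \<open>\<beta>\<close> without its
  first block \<open>b\<close> in degree \<open>b\<close>.
\<close>
fun M_poly :: "'k::comm_ring_1 \<Rightarrow> nat list \<Rightarrow> 'k qsym poly" where
  "M_poly r [] = 1"
| "M_poly r (b # \<beta>) =
     poly_scale (r ^ length \<beta>) (monom (M_basis \<beta>) b + [:r *\<^sub>Q M_basis (b # \<beta>):])"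

lemma glue_monom:
  assumes "0 < x" "\<beta> \<in> Comp"
  shows "glue r x (monom (M_basis \<beta>) b) = monom (M_basis \<beta>) (x + b) + [:r *\<^sub>Q M_basis ((x + b) # \<beta>):]"
  using assms by (simp add: glue_def with_front_def mult_monom front_monom_M)

text \<open>
  Gluing \<open>x\<close> to a coarsening of \<open>w\<close> yields the two coarsenings of \<open>xw\<close> that it induces, the first from the
  constant coefficient and the second from the rest.
\<close>
lemma glue_M_poly:
  assumes x: "0 < x" and \<beta>: "\<beta> \<in> Comp"
  shows "glue r x (M_poly r \<beta>) = M_poly r (x # \<beta>) + (if \<beta> = [] then 0 else M_poly r (merge x \<beta>))"
proof (cases \<beta>)
  case Nil
  then show ?thesis using glue_monom[OF x \<beta>, of r 0] x by (simp add: M_basis_Nil monom_0 one_pCons)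
next
  case (Cons b \<gamma>)
  interpret g: module_hom poly_scale poly_scale "glue r x" by (rule glue_hom)
  have \<gamma>: "\<gamma> \<in> Comp" and b: "0 < b" using \<beta> Cons by auto
  have "M_poly r \<beta> = poly_scale (r ^ length \<gamma>) (monom (M_basis \<gamma>) b) + poly_scale (r ^ length \<beta>) (monom (M_basis \<beta>) 0)"
    by (simp add: Cons poly_scale_def scalar_mult[symmetric] monom_0 smult_add_right ac_simps)
  then show ?thesis
    using glue_monom[OF x \<beta>, of r 0] glue_monom[OF x \<gamma>, of r b]
    by (simp add: g.add g.scale Cons)
qed

lemma eta_poly_eq_sum: "w \<in> Comp \<Longrightarrow> eta_poly r w = (\<Sum>\<beta> \<in> coarsenings w. M_poly r \<beta>)"
proof (induction w)
  case (Cons x w)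
  then have x: "0 < x" and w: "w \<in> Comp" by auto
  have "eta_poly r (x # w) = (\<Sum>\<beta> \<in> coarsenings w. glue r x (M_poly r \<beta>))"
    using Cons.IH[OF w] by (simp add: module_hom.sum[OF glue_hom])
  also have "\<dots> = (\<Sum>\<beta> \<in> coarsenings (x # w). M_poly r \<beta>)"
    unfolding sum_coarsenings_Cons[OF w]
    by (intro sum.cong refl glue_M_poly x coarsenings_Comp[OF _ w])
  finally show ?case .
qed simp

lemma eta_eq_coeff_eta_poly:
  assumes "\<alpha> \<in> Comp"
  shows "eta q \<alpha> = poly.coeff (eta_poly (q + 1) \<alpha>) 0"
proof -
  have "poly.coeff (M_poly r \<beta>) 0 = r ^ length \<beta> *\<^sub>Q M_basis \<beta>" if "\<beta> \<in> Comp" for r :: 'a and \<beta>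
    using that by (cases \<beta>) (auto simp: M_basis_Nil mult.commute)
  then show ?thesis
    using coarsenings_Comp[OF _ assms]
    by (simp add: eta_eq_sum_coarsenings[OF assms] eta_poly_eq_sum[OF assms] coeff_sum)
qed

section \<open>Antipode\<close>

text \<open>
  On \<open>M\<^sub>\<beta>\<close> the antipode is, up to sign, the sum over the coarsenings of \<open>rev \<beta>\<close>, which is the \<open>\<eta>\<close>-function for
  \<open>q = 0\<close>.  Reversal is a bijection between the coarsenings of \<open>\<alpha>\<close> and those of \<open>rev \<alpha>\<close>.
\<close>
lemma antipode_eta:
  assumes \<alpha>: "\<alpha> \<in> Comp"
  shows "antipode (eta q \<alpha>) = (\<Sum>\<beta> \<in> coarsenings (rev \<alpha>). (- (q + 1)) ^ length \<beta> *\<^sub>Q eta 0 \<beta>)"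
proof -
  interpret a: module_hom qsym_scale qsym_scale antipode by (rule antipode_hom)
  have M: "antipode (M_basis \<beta>) = (-1) ^ length \<beta> *\<^sub>Q eta 0 (rev \<beta>)" if "\<beta> \<in> Comp" for \<beta> :: "nat list"
    using that antipode_M[of \<beta> "sum_list \<beta>"] by (simp add: eta_def Comp_of_def)
  have "antipode (eta q \<alpha>) = (\<Sum>\<beta> \<in> coarsenings \<alpha>. (- (q + 1)) ^ length \<beta> *\<^sub>Q eta 0 (rev \<beta>))"
    unfolding eta_eq_sum_coarsenings[OF \<alpha>] a.sum a.scale
    using coarsenings_Comp[OF _ \<alpha>]
    by (intro sum.cong) (auto simp: M power_mult_distrib[symmetric])
  also have "\<dots> = (\<Sum>\<beta> \<in> coarsenings (rev \<alpha>). (- (q + 1)) ^ length \<beta> *\<^sub>Q eta 0 \<beta>)"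
    by (simp add: coarsenings_rev sum.reindex)
  finally show ?thesis .
qed

text \<open>
  Unfolding the recursion gives \<open>(-1)\<^bsup>\<ell>(w)\<^esup> \<Sum> (q - 1)\<^bsup>\<ell>(w) - \<ell>(\<beta>)\<^esup> P\<^sub>\<beta>\<close>, the sum being over the coarsenings \<open>\<beta>\<close> of \<open>w\<close>;
  note \<open>r - 2 = q - 1\<close>.
\<close>
fun antipode_poly :: "'k::comm_ring_1 \<Rightarrow> nat list \<Rightarrow> 'k qsym poly" where
  "antipode_poly r [] = 1"
| "antipode_poly r (x # w) =
     - (glue r x (antipode_poly r w) + poly_scale (r - 2) (glue r x (strip (antipode_poly r w))))"

lemma antipode_poly_in_word_span:
  assumes pos: "Y \<subseteq> {1..}" and Y: "\<And>y z. y \<in> Y \<Longrightarrow> z \<in> Y \<Longrightarrow> y + z \<in> Y"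
    and "w \<in> lists Y"
  shows "antipode_poly r w \<in> word_span r Y"
  using assms(3)
proof (induction w)
  case Nil
  have "eta_poly r [] \<in> word_span r Y" unfolding word_span_def by (rule pmod.span_base) blast
  then show ?case by simp
next
  case (Cons x w)
  then have "glue r x (antipode_poly r w) \<in> word_span r Y"
      "glue r x (strip (antipode_poly r w)) \<in> word_span r Y"
    using glue_word_span merge_word_span[OF _ _ pos Y] by auto
  then show ?case unfolding word_span_def antipode_poly.simps
    by (intro pmod.span_neg pmod.span_add pmod.span_scale)
qed

text \<open>
  The expansion \<open>antipode_eta\<close> uses the \<open>\<eta>\<close>-functions for \<open>q = 0\<close>, that is, gluing with parameter 1 instead of \<open>r\<close>.  The
  corresponding polynomials \<open>U\<close> satisfy a recursion of the same shape as \<open>antipode_poly\<close>.  The two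
  families have the same constant coefficients although the polynomials differ: in positive degrees \<open>U\<close> is larger by
  the factor \<open>r\<close>.  Both statements are needed together for the induction.
\<close>
lemma antipode_poly_eq:
  fixes r :: "'a::comm_ring_1"
  assumes "w \<in> Comp"
  defines "U \<equiv> \<lambda>w. \<Sum>\<beta> \<in> coarsenings w. poly_scale ((- r) ^ length \<beta>) (eta_poly 1 \<beta>)"
  shows "poly.coeff (antipode_poly r w) 0 = poly.coeff (U w) 0 \<and> strip (U w) = poly_scale r (strip (antipode_poly r w))"
  using assms(1)
proof (induction w)
  case Nil
  then show ?case by (simp add: U_def)
next
  case (Cons x w)
  then have x: "0 < x" and w: "w \<in> Comp" by auto
  interpret gr: module_hom poly_scale poly_scale "glue r x" by (rule glue_hom)
  interpret g1: module_hom poly_scale poly_scale "glue 1 x :: 'a qsym poly \<Rightarrow> _" by (rule glue_hom)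
  interpret s: module_hom poly_scale poly_scale "strip :: 'a qsym poly \<Rightarrow> _" by (rule strip_hom)
  define W where "W = antipode_poly r w"
  define V where "V = W + poly_scale (r - 2) (strip W)"
  have IH: "poly.coeff W 0 = poly.coeff (U w) 0" "strip (U w) = poly_scale r (strip W)"
    using Cons.IH[OF w] by (simp_all add: W_def)
  have strip_decomp: "P = [:poly.coeff P 0:] + strip P" for P :: "'a qsym poly"
    by (simp add: strip_def)
  \<comment> \<open>The two coarsenings of \<open>xw\<close> induced by \<open>\<beta>\<close>: the longer one picks up a further factor \<open>- r\<close>, the merged one does not.\<close>
  have step: "poly_scale ((- r) ^ length (x # \<beta>)) (eta_poly 1 (x # \<beta>))
        + (if \<beta> = [] then 0 else poly_scale ((- r) ^ length (merge x \<beta>)) (eta_poly 1 (merge x \<beta>)))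
      = glue 1 x (poly_scale (- r) (poly_scale ((- r) ^ length \<beta>) (eta_poly 1 \<beta>))
          + strip (poly_scale ((- r) ^ length \<beta>) (eta_poly 1 \<beta>)))"
    if "\<beta> \<in> Comp" for \<beta>
    using that by (cases \<beta>) (auto simp: g1.add g1.scale g1.neg g1.diff s.scale s.neg merge_glue)
  have "U (x # w) = (\<Sum>\<beta> \<in> coarsenings w.
      glue 1 x (poly_scale (- r) (poly_scale ((- r) ^ length \<beta>) (eta_poly 1 \<beta>))
          + strip (poly_scale ((- r) ^ length \<beta>) (eta_poly 1 \<beta>))))"
    unfolding U_def sum_coarsenings_Cons[OF w]
    by (intro sum.cong refl step coarsenings_Comp[OF _ w])
  also have "\<dots> = glue 1 x (poly_scale (- r) (U w) + strip (U w))"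
    by (simp only: U_def g1.sum s.sum pmod.scale_sum_right flip: sum.distrib)
  also have "poly_scale (- r) (U w) + strip (U w) = poly_scale (- r) V"
  proof -
    define c B where "c = poly.coeff W 0" and "B = strip W"
    have W: "W = [:c:] + B" and U: "U w = [:c:] + poly_scale r B"
      using strip_decomp[of W] strip_decomp[of "U w"] IH by (simp_all add: c_def B_def)
    show ?thesis
      unfolding IH(2) unfolding V_def U B_def[symmetric] unfolding W poly_scale_def
      by (simp add: algebra_simps smult_diff_left smult_add_left) (use scalar_hom(3)[of 1 "1::'a"] in
          \<open>simp add: numeral_poly\<close>)
  qed
  finally have U: "U (x # w) = glue 1 x (poly_scale (- r) V)" .
  have W: "antipode_poly r (x # w) = glue r x (poly_scale (- 1) V)"
    by (simp add: V_def gr.add gr.scale gr.neg gr.diff W_def)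
  show ?case unfolding U W
    using x by (simp add: coeff_glue strip_glue poly_scale_mult front_scale front_minus)
qed

lemma antipode_eta_eq_coeff:
  assumes "\<alpha> \<in> Comp"
  shows "antipode (eta q \<alpha>) = poly.coeff (antipode_poly (q + 1) (rev \<alpha>)) 0"
proof -
  have "rev \<alpha> \<in> Comp" using assms by simp
  then show ?thesis
    using antipode_poly_eq[of "rev \<alpha>" "q + 1"] coarsenings_Comp
    unfolding antipode_eta[OF assms]
    by (auto simp: coeff_sum eta_eq_coeff_eta_poly intro!: sum.cong)
qed

section \<open>Coproduct\<close>

lemma tensor_sum_left: "(\<Sum>x\<in>A. f x) \<otimes>\<^sub>Q g = (\<Sum>x\<in>A. f x \<otimes>\<^sub>Q g)"
proof -
  have "0 \<otimes>\<^sub>Q g = 0" using tensor_bilinear(1)[of 0 0 g] by simp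
  then show ?thesis by (induction A rule: infinite_finite_induct) (simp_all add: tensor_bilinear)
qed

lemma tensor_sum_right: "f \<otimes>\<^sub>Q (\<Sum>x\<in>A. g x) = (\<Sum>x\<in>A. f \<otimes>\<^sub>Q g x)"
proof -
  have "f \<otimes>\<^sub>Q 0 = 0" using tensor_bilinear(2)[of f 0 0] by simp
  then show ?thesis by (induction A rule: infinite_finite_induct) (simp_all add: tensor_bilinear)
qed

lemma finite_splittings [simp]: "finite {(v, w). v @ w = u}"
proof (rule finite_subset)
  show "{(v, w). v @ w = u} \<subseteq> (\<lambda>i. (take i u, drop i u)) ` {..length u}"
  proof clarify
    fix v w assume "u = v @ w"
    then show "(v, w) \<in> (\<lambda>i. (take i (v @ w), drop i (v @ w))) ` {..length (v @ w)}"
      by (intro image_eqI[of _ _ "length v"]) auto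
  qed
qed simp

text \<open>
  If one of the first pieces were longer than the other, its additional entries would be positive and
  increase its size.
\<close>
lemma append_eq_append_sum_list:
  assumes "v @ w = v' @ w'" "sum_list v = sum_list v'" "v \<in> Comp" "v' \<in> Comp"
  shows "v = v'" "w = w'"
proof -
  have nil: "u = []" if "s @ u \<in> Comp" "sum_list (s @ u) = sum_list s" for s u :: "nat list"
    using that by (cases u) (auto simp: Comp_def)
  from assms(1) obtain u where "v = v' @ u \<and> u @ w = w' \<or> v @ u = v' \<and> w = u @ w'"
    unfolding append_eq_append_conv2 by metis
  then have "v = v' \<and> w = w'"
  proof
    assume "v = v' @ u \<and> u @ w = w'"
    then show ?thesis using nil[of v' u] assms(2,3) by auto
  next
    assume "v @ u = v' \<and> w = u @ w'"
    then show ?thesis using nil[of v u] assms(2,4) by auto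
  qed
  then show "v = v'" "w = w'" by auto
qed

text \<open>
  A pair of compositions whose concatenation coarsens \<open>\<alpha>\<close> is a pair of coarsenings of the pieces of a cut of \<open>\<alpha>\<close>; this cut is
  unique, as coarsening preserves sizes.
\<close>
lemma coproduct_eta:
  assumes \<alpha>: "\<alpha> \<in> Comp"
  shows "coproduct (eta q \<alpha>) = (\<Sum>(v, w) | v @ w = \<alpha>. eta q v \<otimes>\<^sub>Q eta q w)"
proof -
  interpret c: module_hom qsym_scale tensor_scale coproduct by (rule coproduct_hom)
  let ?r = "q + 1"
  define t where "t = (\<lambda>(\<beta>, \<gamma>). tensor_scale (?r ^ length (\<beta> @ \<gamma>)) (M_basis \<beta> \<otimes>\<^sub>Q M_basis \<gamma>))"
  have sub: "v \<in> Comp \<and> w \<in> Comp" if "v @ w = \<alpha>" for v w using that \<alpha> by (auto simp: Comp_def)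
  have "coproduct (eta q \<alpha>) = (\<Sum>\<beta> \<in> coarsenings \<alpha>. \<Sum>p \<in> {(\<beta>', \<beta>''). \<beta>' @ \<beta>'' = \<beta>}. t p)"
    unfolding eta_eq_sum_coarsenings[OF \<alpha>] c.sum c.scale
    using coarsenings_Comp[OF _ \<alpha>]
    by (intro sum.cong refl) (auto simp: coproduct_M tensor.scale_sum_right t_def intro!: sum.cong)
  also have "\<dots> = (\<Sum>p \<in> (\<Union>\<beta> \<in> coarsenings \<alpha>. {(\<beta>', \<beta>''). \<beta>' @ \<beta>'' = \<beta>}). t p)"
    by (rule sum.UNION_disjoint[symmetric]) auto
  also have "(\<Union>\<beta> \<in> coarsenings \<alpha>. {(\<beta>', \<beta>''). \<beta>' @ \<beta>'' = \<beta>})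
      = (\<Union>(v, w) \<in> {(v, w). v @ w = \<alpha>}. coarsenings v \<times> coarsenings w)"
  proof (rule set_eqI)
    fix p
    have "p \<in> (\<Union>\<beta> \<in> coarsenings \<alpha>. {(\<beta>', \<beta>''). \<beta>' @ \<beta>'' = \<beta>}) \<longleftrightarrow> fst p @ snd p \<in> coarsenings \<alpha>"
      by (cases p) simp
    also have "\<dots> \<longleftrightarrow> p \<in> (\<Union>(v, w) \<in> {(v, w). v @ w = \<alpha>}. coarsenings v \<times> coarsenings w)"
      unfolding append_in_coarsenings_iff by (cases p) simp
    finally show "p \<in> (\<Union>\<beta> \<in> coarsenings \<alpha>. {(\<beta>', \<beta>''). \<beta>' @ \<beta>'' = \<beta>}) \<longleftrightarrow>
      p \<in> (\<Union>(v, w) \<in> {(v, w). v @ w = \<alpha>}. coarsenings v \<times> coarsenings w)" .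
  qed
  also have "(\<Sum>p \<in> \<dots>. t p) = (\<Sum>(v, w) | v @ w = \<alpha>. \<Sum>p \<in> coarsenings v \<times> coarsenings w. t p)"
  proof (subst sum.UNION_disjoint)
    show "\<forall>i \<in> {(v, w). v @ w = \<alpha>}. \<forall>j \<in> {(v, w). v @ w = \<alpha>}. i \<noteq> j \<longrightarrow>
      (case i of (v, w) \<Rightarrow> coarsenings v \<times> coarsenings w) \<inter>
      (case j of (v, w) \<Rightarrow> coarsenings v \<times> coarsenings w) = {}"
    proof (intro ballI impI, rule ccontr)
      fix i j assume ij: "i \<in> {(v, w). v @ w = \<alpha>}" "j \<in> {(v, w). v @ w = \<alpha>}" "i \<noteq> j"
        and overlap: "(case i of (v, w) \<Rightarrow> coarsenings v \<times> coarsenings w) \<inter>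
          (case j of (v, w) \<Rightarrow> coarsenings v \<times> coarsenings w) \<noteq> {}"
      obtain v w v' w' where i: "i = (v, w)" and j: "j = (v', w')" by (metis surj_pair)
      have eq: "v @ w = \<alpha>" "v' @ w' = \<alpha>" using ij i j by simp_all
      obtain \<beta> where "\<beta> \<in> coarsenings v" "\<beta> \<in> coarsenings v'" using overlap i j by auto
      then have "sum_list v = sum_list v'"
        using coarsenings_sum_list[of \<beta> v] coarsenings_sum_list[of \<beta> v'] by simp
      moreover have "v @ w = v' @ w'" using eq by simp
      moreover have "v \<in> Comp" "v' \<in> Comp" using sub eq by blast+
      ultimately have "v = v'" "w = w'" using append_eq_append_sum_list[of v w v' w'] by blast+
      then show False using ij(3) i j by simp
    qed
  qed (use finite_splittings[of \<alpha>] in \<open>auto simp: case_prod_unfold\<close>)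
  also have "\<dots> = (\<Sum>(v, w) | v @ w = \<alpha>. eta q v \<otimes>\<^sub>Q eta q w)"
  proof (intro sum.cong refl, clarify)
    fix v w assume "\<alpha> = v @ w"
    then have "v \<in> Comp" "w \<in> Comp" using sub by auto
    then have "eta q v \<otimes>\<^sub>Q eta q w = (\<Sum>\<beta> \<in> coarsenings v. \<Sum>\<gamma> \<in> coarsenings w. t (\<beta>, \<gamma>))"
      by (simp only: eta_eq_sum_coarsenings tensor_sum_left)
        (simp add: tensor_sum_right tensor_bilinear(3,4) t_def power_add mult.commute)
    then show "(\<Sum>p \<in> coarsenings v \<times> coarsenings w. t p) = eta q v \<otimes>\<^sub>Q eta q w"
      by (simp add: sum.cartesian_product)
  qed
  finally show ?thesis .
qed

section \<open>The Hopf subalgebra\<close>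

lemma coeff_word_span:
  assumes "Y \<subseteq> {1..}" and "P \<in> word_span (q + 1) Y"
  shows "poly.coeff P 0 \<in> QSym_on q {\<alpha> \<in> Comp. set \<alpha> \<subseteq> Y}"
  using assms(2) unfolding word_span_def QSym_on_def
proof (induction rule: pmod.span_induct_alt)
  case base
  then show ?case by (simp add: qsym.span_zero)
next
  case (step c Q P)
  then obtain w where w: "Q = eta_poly (q + 1) w" "w \<in> lists Y" by blast
  then have "w \<in> Comp" using assms(1) by (auto simp: Comp_def)
  then have "poly.coeff Q 0 \<in> qsym_span (eta q ` {\<alpha> \<in> Comp. set \<alpha> \<subseteq> Y})"
    using w by (intro qsym.span_base) (auto simp: eta_eq_coeff_eta_poly)
  then show ?case using step by (simp add: qsym.span_add qsym.span_scale)
qed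

lemma QSym_on_subspace: "module.subspace qsym_scale (QSym_on q T)"
  unfolding QSym_on_def qsym_subspace_def[symmetric] by (rule qsym.subspace_span)

lemma eta_in_QSym_on: "\<alpha> \<in> T \<Longrightarrow> eta q \<alpha> \<in> QSym_on q T"
  unfolding QSym_on_def by (intro qsym.span_base imageI)

text \<open>
  Multiplication by a fixed element, the antipode and the coproduct are all linear, so each closure property only has to be
  checked on the \<open>\<eta>\<close>-functions.
\<close>
lemma QSym_on_hom:
  assumes L: "module_hom qsym_scale s L" and V: "module.subspace s V"
    and eta: "\<And>\<alpha>. \<alpha> \<in> T \<Longrightarrow> L (eta q \<alpha>) \<in> V"
    and f: "f \<in> QSym_on q T"
  shows "L f \<in> V"
proof -
  interpret L: module_hom qsym_scale s L by (rule L)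
  have "qsym_subspace {f. L f \<in> V}"
    using V unfolding qsym.subspace_def L.m2.subspace_def by (auto simp: L.zero L.add L.scale)
  moreover have "eta q ` T \<subseteq> {f. L f \<in> V}" using eta by blast
  ultimately show ?thesis using f qsym.span_minimal unfolding QSym_on_def by blast
qed

theorem proposition6p3:
  fixes q :: "'k::comm_ring_1" and Y :: "nat set"
  assumes "Y \<subseteq> {1..}"
    and "\<And>y z. y \<in> Y \<Longrightarrow> z \<in> Y \<Longrightarrow> y + z \<in> Y"
  shows "hopf_subalgebra (QSym_on q {\<alpha> \<in> Comp. set \<alpha> \<subseteq> Y})"
proof -
  let ?T = "{\<alpha> \<in> Comp. set \<alpha> \<subseteq> Y}"
  let ?D = "QSym_on q ?T"
  have mult_hom: "module_hom qsym_scale qsym_scale (\<lambda>f. f * g)" for g :: "'k qsym"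
    by unfold_locales (simp_all add: distrib_right scale_mult)
  have one: "1 \<in> ?D"
    using eta_in_QSym_on[of "[]" ?T q] by (simp add: eta_eq_coeff_eta_poly)
  have eta_mult: "eta q v * eta q w \<in> ?D" if "v \<in> ?T" "w \<in> ?T" for v w
  proof -
    have "poly.coeff (twisted_mult (q + 1) (eta_poly (q + 1) v) (eta_poly (q + 1) w)) 0 \<in> ?D"
      using that assms by (intro coeff_word_span twisted_mult_eta_poly_word_span) auto
    then show ?thesis using that by (simp add: twisted_mult_def strip_def coeff_mult_0 eta_eq_coeff_eta_poly)
  qed
  have mult_eta: "g * eta q w \<in> ?D" if "g \<in> ?D" "w \<in> ?T" for g w
    by (rule QSym_on_hom[OF mult_hom QSym_on_subspace _ that(1)]) (rule eta_mult[OF _ that(2)])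
  have mult: "f * g \<in> ?D" if "f \<in> ?D" "g \<in> ?D" for f g
  proof (rule QSym_on_hom[OF mult_hom QSym_on_subspace _ that(1)])
    fix \<alpha> assume "\<alpha> \<in> ?T"
    then show "eta q \<alpha> * g \<in> ?D" using mult_eta[OF that(2)] by (simp only: mult.commute)
  qed
  have "antipode (eta q \<alpha>) \<in> ?D" if "\<alpha> \<in> ?T" for \<alpha>
  proof -
    have "antipode_poly (q + 1) (rev \<alpha>) \<in> word_span (q + 1) Y"
      using that by (intro antipode_poly_in_word_span assms) auto
    then show ?thesis using that coeff_word_span[OF assms(1)] by (simp add: antipode_eta_eq_coeff)
  qed
  then have antipode: "antipode f \<in> ?D" if "f \<in> ?D" for f
    using that by (rule QSym_on_hom[OF antipode_hom QSym_on_subspace])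
  let ?DD = "tensor_span {f \<otimes>\<^sub>Q g | f g. f \<in> ?D \<and> g \<in> ?D}"
  have "coproduct (eta q \<alpha>) \<in> ?DD" if "\<alpha> \<in> ?T" for \<alpha>
  proof -
    have "eta q v \<otimes>\<^sub>Q eta q w \<in> ?DD" if "v @ w = \<alpha>" for v w
    proof -
      have "v \<in> ?T" "w \<in> ?T" using that \<open>\<alpha> \<in> ?T\<close> by (auto simp: Comp_def)
      then have "eta q v \<in> ?D" "eta q w \<in> ?D" by (simp_all add: eta_in_QSym_on)
      then show ?thesis by (intro tensor.span_base) blast
    qed
    then show ?thesis using that by (auto simp: coproduct_eta intro!: tensor.span_sum)
  qed
  then have coproduct: "coproduct f \<in> ?DD" if "f \<in> ?D" for f
    using that by (rule QSym_on_hom[OF coproduct_hom tensor.subspace_span])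
  show ?thesis
    unfolding hopf_subalgebra_def subalgebra_def subcoalgebra_def qsym_subspace_def
    by (intro conjI ballI image_subsetI QSym_on_subspace one mult antipode coproduct)
qed

end
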